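(* Consider the vertical model described in the context with $\alpha=\beta=1$, and for a state $(\mathbf x,\mathbf y)$ let $IB=\tilde x_m-\tilde y_n$. For any $i\in\mathcal D$, $j\in\mathcal S$ and $t=1,\dots,T$, there exist protection levels $p_{ij,d}^{t,IB}$ and $p_{ij,s}^{t,IB}$ dependent on $IB$ such that $p_{ij,d}^{t,IB}-p_{ij,s}^{t,IB}=\tilde x_m-\tilde y_n$, and that in period $t$: (i) the one-step-ahead policy matches $i$ and $j$ only if $\tilde x_i>\tilde y_{j-1}$ and $\tilde y_j>\tilde x_{i-1}$; (ii) when the one-step-ahead policy matches $i$ and $j$, it aims to reduce the total available demand to the protection level $p_{ij,d}^{t,IB}$ and the total available supply to $p_{ij,s}^{t,IB}$, or as close as possible. That is, if $\tilde x_i>\tilde y_{j-1}$ and $\tilde y_j>\tilde x_{i-1}$, then with $L=\max\{\tilde x_{i-1},\tilde y_{j-1}\}$ and $M=\min\{\tilde x_i,\tilde y_j\}$ the quantity matched between $i$ and $j$ is $$\min\big\{M-L,\ (\tilde x_m-L-p_{ij,d}^{t,IB})^+\big\}=\min\big\{M-L,\ (\tilde y_n-L-p_{ij,s}^{t,IB})^+\big\};$$ (iii) $p_{ij,d}^{t,IB}$ is increasing in $IB$ with the increasing rate no greater than $1$, and $p_{ij,s}^{t,IB}$ is decreasing in $IB$ with the decreasing rate no greater than $1$.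
   Context: Model. $T,m,n\ge1$ are integers, $\alpha,\beta\in[0,1]$ are the carry-over fractions of unmatched demand and supply (here $\alpha=\beta=1$), demand types $\mathcal D=\{1,\dots,m\}$, supply types $\mathcal S=\{1,\dots,n\}$, real unit matching rewards $r_{ij}^t$ ($1\le t\le T$). In each period $t$ random vectors $\mathbf D^t\in\mathbb R_+^m,\mathbf S^t\in\mathbb R_+^n$ of new demand and supply arrive; their distributions do not depend on matching decisions. The state $(\mathbf x,\mathbf y)\in\mathbb R_+^m\times\mathbb R_+^n$ in period $t$ lists available quantities after the arrivals of period $t$. A feasible decision is $\mathbf Q=(q_{ij})\in\mathbb R_+^{m\times n}$ with $u_i=x_i-\sum_jq_{ij}\ge0$, $v_j=y_j-\sum_iq_{ij}\ge0$; it earns $\sum_{i,j}r_{ij}^tq_{ij}$ in period $t$ and the next state is $(\alpha\mathbf u+\mathbf D^{t+1},\beta\mathbf v+\mathbf S^{t+1})$. Vertical model. $r_{ij}^t=r_{id}^t+r_{js}^t$ with $r_{1d}^t>\dots>r_{md}^t$, $r_{1s}^t>\dots>r_{ns}^t$ (smaller index means higher quality), $r_{m+1,d}^t=r_{n+1,s}^t=0$; for $t=1,\dots,T-1$, $i=1,\dots,m$, $j=1,\dots,n$: $r_{id}^t-r_{i+1,d}^t\ge\alpha(r_{id}^{t+1}-r_{i+1,d}^{t+1})$ and $r_{js}^t-r_{j+1,s}^t\ge\beta(r_{js}^{t+1}-r_{j+1,s}^{t+1})$. Notation. $\tilde x_i=\sum_{k\le i}x_k$, $\tilde y_j=\sum_{k\le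 j}y_k$, $\tilde x_0=\tilde y_0=0$, $a^+=\max\{a,0\}$. Top-down matching with total quantity $Q\in[0,\min\{\tilde x_m,\tilde y_n\}]$ is the decision $q_{ij}=(\min\{\tilde x_i,\tilde y_j,Q\}-\max\{\tilde x_{i-1},\tilde y_{j-1}\})^+$. The greedy policy uses top-down matching with $Q=\min\{\tilde x_m,\tilde y_n\}$ in every period; $V_t^g(\mathbf x,\mathbf y)$ is its expected total reward from period $t$ to $T$ starting in state $(\mathbf x,\mathbf y)$, $V_{T+1}^g\equiv0$. The one-step-ahead policy uses, in every period $t$ and state, top-down matching with a total quantity $Q$ maximizing over $[0,\min\{\tilde x_m,\tilde y_n\}]$ the immediate reward plus $E\,V_{t+1}^g(\alpha\mathbf u+\mathbf D^{t+1},\beta\mathbf v+\mathbf S^{t+1})$.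
   Formalization: Protection levels may equal +∞ (never match i and j), the difference being read as p_d = p_s + IB, since real levels can fail to exist with unbounded arrivals; and the one-step-ahead policy is taken to use the largest maximizing total quantity Q when maximizers are not unique. *)

theory Defs
  imports "HOL-Probability.Probability"
begin

(* Types, periods and the components of state vectors are indexed from 1; entries of a
   vector outside 1..m (demand) or 1..n (supply) are never read. *)

type_synonym state_vec = "nat \<Rightarrow> real"
type_synonym decision = "nat \<Rightarrow> nat \<Rightarrow> real"
type_synonym policy = "nat \<Rightarrow> state_vec \<Rightarrow> state_vec \<Rightarrow> decision"

record 'w matching_model =
  horizon :: nat
  num_demand :: nat
  num_supply :: nat
  carry_demand :: real
  carry_supply :: real
  unit_reward :: "nat \<Rightarrow> nat \<Rightarrow> nat \<Rightarrow> real"    (* period, demand type, supply type *)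
  prob_measure :: "'w measure"
  new_demand :: "nat \<Rightarrow> nat \<Rightarrow> 'w \<Rightarrow> real"
  new_supply :: "nat \<Rightarrow> nat \<Rightarrow> 'w \<Rightarrow> real"

(* The arrivals are functions of the sample point only, hence unaffected by decisions.
   No condition is placed on their joint law across periods. *)
definition matching_model :: "'w matching_model \<Rightarrow> bool" where
  "matching_model P \<longleftrightarrow>
     1 \<le> horizon P \<and> 1 \<le> num_demand P \<and> 1 \<le> num_supply P \<and>
     0 \<le> carry_demand P \<and> carry_demand P \<le> 1 \<and>
     0 \<le> carry_supply P \<and> carry_supply P \<le> 1 \<and>
     prob_space (prob_measure P) \<and>
     (\<forall>t\<in>{1..horizon P}. \<forall>i\<in>{1..num_demand P}.
        new_demand P t i \<in> borel_measurable (prob_measure P) \<and>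
        (\<forall>\<omega>\<in>space (prob_measure P). 0 \<le> new_demand P t i \<omega>)) \<and>
     (\<forall>t\<in>{1..horizon P}. \<forall>j\<in>{1..num_supply P}.
        new_supply P t j \<in> borel_measurable (prob_measure P) \<and>
        (\<forall>\<omega>\<in>space (prob_measure P). 0 \<le> new_supply P t j \<omega>))"

definition vertical_rewards ::
    "'w matching_model \<Rightarrow> (nat \<Rightarrow> nat \<Rightarrow> real) \<Rightarrow> (nat \<Rightarrow> nat \<Rightarrow> real) \<Rightarrow> bool" where
  "vertical_rewards P rd rs \<longleftrightarrow>
     (\<forall>t\<in>{1..horizon P}. \<forall>i\<in>{1..num_demand P}. \<forall>j\<in>{1..num_supply P}.
        unit_reward P t i j = rd t i + rs t j) \<and>
     (\<forall>t\<in>{1..horizon P}.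
        (\<forall>i\<in>{1..<num_demand P}. rd t i > rd t (i + 1)) \<and>
        (\<forall>j\<in>{1..<num_supply P}. rs t j > rs t (j + 1)) \<and>
        rd t (num_demand P + 1) = 0 \<and> rs t (num_supply P + 1) = 0) \<and>
     (\<forall>t\<in>{1..<horizon P}.
        (\<forall>i\<in>{1..num_demand P}.
           rd t i - rd t (i + 1) \<ge> carry_demand P * (rd (t + 1) i - rd (t + 1) (i + 1))) \<and>
        (\<forall>j\<in>{1..num_supply P}.
           rs t j - rs t (j + 1) \<ge> carry_supply P * (rs (t + 1) j - rs (t + 1) (j + 1))))"

definition is_state :: "'w matching_model \<Rightarrow> state_vec \<Rightarrow> state_vec \<Rightarrow> bool" where
  "is_state P x y \<longleftrightarrow> (\<forall>i\<in>{1..num_demand P}. 0 \<le> x i) \<and> (\<forall>j\<in>{1..num_supply P}. 0 \<le> y j)"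

definition cumul :: "state_vec \<Rightarrow> nat \<Rightarrow> real" where
  "cumul x k = (\<Sum>l=1..k. x l)"

definition imbalance :: "'w matching_model \<Rightarrow> state_vec \<Rightarrow> state_vec \<Rightarrow> real" where
  "imbalance P x y = cumul x (num_demand P) - cumul y (num_supply P)"

definition max_total :: "'w matching_model \<Rightarrow> state_vec \<Rightarrow> state_vec \<Rightarrow> real" where
  "max_total P x y = min (cumul x (num_demand P)) (cumul y (num_supply P))"

definition period_reward :: "'w matching_model \<Rightarrow> nat \<Rightarrow> decision \<Rightarrow> real" where
  "period_reward P t q =
     (\<Sum>i=1..num_demand P. \<Sum>j=1..num_supply P. unit_reward P t i j * q i j)"

definition next_demand :: "'w matching_model \<Rightarrow> nat \<Rightarrow> state_vec \<Rightarrow> decision \<Rightarrow> 'w \<Rightarrow> state_vec" where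
  "next_demand P t x q \<omega> =
     (\<lambda>i. carry_demand P * (x i - (\<Sum>j=1..num_supply P. q i j)) + new_demand P (t + 1) i \<omega>)"

definition next_supply :: "'w matching_model \<Rightarrow> nat \<Rightarrow> state_vec \<Rightarrow> decision \<Rightarrow> 'w \<Rightarrow> state_vec" where
  "next_supply P t y q \<omega> =
     (\<lambda>j. carry_supply P * (y j - (\<Sum>i=1..num_demand P. q i j)) + new_supply P (t + 1) j \<omega>)"

(* Reward collected along one sample path in k consecutive periods, the first being t. *)
primrec path_reward ::
    "'w matching_model \<Rightarrow> policy \<Rightarrow> 'w \<Rightarrow> nat \<Rightarrow> nat \<Rightarrow> state_vec \<Rightarrow> state_vec \<Rightarrow> real" where
  "path_reward P \<pi> \<omega> 0 t x y = 0"
| "path_reward P \<pi> \<omega> (Suc k) t x y =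
     period_reward P t (\<pi> t x y) +
     path_reward P \<pi> \<omega> k (t + 1)
       (next_demand P t x (\<pi> t x y) \<omega>) (next_supply P t y (\<pi> t x y) \<omega>)"

(* Zero for t = T + 1.  No moments of the arrivals are assumed: if the expected reward
   does not exist, the Bochner integral is 0 by convention. *)
definition policy_value :: "'w matching_model \<Rightarrow> policy \<Rightarrow> nat \<Rightarrow> state_vec \<Rightarrow> state_vec \<Rightarrow> real" where
  "policy_value P \<pi> t x y =
     (\<integral>\<omega>. path_reward P \<pi> \<omega> (horizon P + 1 - t) t x y \<partial>prob_measure P)"

definition top_down :: "state_vec \<Rightarrow> state_vec \<Rightarrow> real \<Rightarrow> decision" where
  "top_down x y Q = (\<lambda>i j.
     max 0 (min (min (cumul x i) (cumul y j)) Q - max (cumul x (i - 1)) (cumul y (j - 1))))"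

definition greedy_policy :: "'w matching_model \<Rightarrow> policy" where
  "greedy_policy P = (\<lambda>t x y. top_down x y (max_total P x y))"

definition greedy_value :: "'w matching_model \<Rightarrow> nat \<Rightarrow> state_vec \<Rightarrow> state_vec \<Rightarrow> real" where
  "greedy_value P = policy_value P (greedy_policy P)"

definition one_step_objective ::
    "'w matching_model \<Rightarrow> nat \<Rightarrow> state_vec \<Rightarrow> state_vec \<Rightarrow> real \<Rightarrow> real" where
  "one_step_objective P t x y Q =
     period_reward P t (top_down x y Q) +
     (\<integral>\<omega>. greedy_value P (t + 1)
             (next_demand P t x (top_down x y Q) \<omega>)
             (next_supply P t y (top_down x y Q) \<omega>) \<partial>prob_measure P)"

definition one_step_maximizer ::
    "'w matching_model \<Rightarrow> nat \<Rightarrow> state_vec \<Rightarrow> state_vec \<Rightarrow> real \<Rightarrow> bool" where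
  "one_step_maximizer P t x y Q \<longleftrightarrow>
     Q \<in> {0..max_total P x y} \<and>
     (\<forall>Q'\<in>{0..max_total P x y}. one_step_objective P t x y Q' \<le> one_step_objective P t x y Q)"

(* Maximizers need not be unique (e.g. when r_1d and r_1s do not change over time); an
   arbitrary choice among them would not depend on the state through protection levels.
   Ties are broken in favour of matching: the largest maximizer is used. *)
definition one_step_policy :: "'w matching_model \<Rightarrow> policy" where
  "one_step_policy P = (\<lambda>t x y. top_down x y (GREATEST Q. one_step_maximizer P t x y Q))"

end

theory Submission
  imports Defs
begin

text \<open>
  Summation by parts turns unit rewards into quality gaps: the demand types \<open>1..i\<close> form a class that
  earns \<open>r\<^sub>i - r\<^sub>i\<^sub>+\<^sub>1\<close> for each of its units that is matched, and likewise for supply. Top-down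
  matching with total \<open>Q\<close> matches \<open>min a Q\<close> units of a class of level (cumulative quantity) \<open>a\<close> and
  leaves \<open>(a - Q)\<^sup>+\<close>. Under the greedy policy a class therefore evolves by itself, given only the total
  demand \<open>z\<close> and the total supply \<open>w\<close>; its future reward is a function \<open>f a z w\<close>.

  Three properties of \<open>f\<close> carry the argument; the last two hold for every class but the whole demand
  and the whole supply. Matching \<open>s\<close> more units beforehand, all from within the
  class, costs exactly \<open>g s\<close>, where \<open>g\<close> is the quality gap of the coming period (\<open>shift_covariant\<close>). In
  its level, \<open>f\<close> is concave with slope between \<open>0\<close> and \<open>g\<close>; and its increments in the level grow with
  \<open>z\<close> and \<open>w\<close>, since more total supply and demand serve the class sooner (both: \<open>diminishing\<close>). One
  greedy period preserves these properties (\<open>diminishing_serve\<close>) because quality gaps do not grow over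
  time, and so does averaging over the arrivals (\<open>diminishing_mean_change\<close>).

  Consequently the one-step-ahead objective is concave in \<open>Q\<close> (\<open>one_step_objective_regular\<close>). While \<open>i\<close>
  and \<open>j\<close> are being matched, that is for \<open>Q\<close> between \<open>L\<close> and \<open>M\<close>, the classes above \<open>i\<close> and \<open>j\<close> are exhausted
  and all others still contain at least \<open>Q\<close> units; by shift covariance the objective is then a constant
  plus a concave function \<open>h b z\<close> of the remaining total demand \<open>z = x\<^sub>m - Q\<close> and the imbalance \<open>b\<close>, the same
  for all states (\<open>matching_profile\<close>). The demand protection level is the least feasible \<open>z\<close>
  (at least \<open>max 0 b\<close>) beyond which \<open>h b\<close> no longer rises. Concavity lets the local comparison decide how far the global maximizer
  reaches into \<open>[L, M]\<close>. Increasing differences in total supply make the protection level increasing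
  in \<open>b\<close>; increasing differences in total demand bound its rate by \<open>1\<close>.

  Expectations need not exist. The greedy rewards from two states differ by a bounded amount, so
  they are integrable for all states or for none; in the latter case the continuation value is \<open>0\<close>
  everywhere and the objective reduces to the immediate reward (\<open>expected_class_sum\<close>).
\<close>

section \<open>Concave functions on the real line\<close>

lemma concave_on_affine_plus:
  assumes "concave_on S f" shows "concave_on S (\<lambda>a::real. f a + (p * a + r))"
proof (rule concave_on_add[OF assms])
  have "convex S" using assms by (simp add: concave_on_iff)
  then show "concave_on S (\<lambda>a. p * a + r)"
    unfolding concave_on_iff
    by (auto simp: algebra_simps) (metis distrib_left mult.commute mult_1 order_refl)
qed

lemma concave_on_translate:
  fixes f :: "real \<Rightarrow> real"
  assumes "concave_on UNIV f"
  shows "concave_on UNIV (\<lambda>a. f (a + C))"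
  unfolding concave_on_iff
proof (intro conjI ballI allI impI)
  fix x y u v :: real assume uv: "0 \<le> u" "0 \<le> v" "u + v = 1"
  have "u * f (x + C) + v * f (y + C) \<le> f (u * (x + C) + v * (y + C))"
    using assms uv by (simp add: concave_on_iff)
  also have "u * (x + C) + v * (y + C) = u * x + v * y + (u + v) * C"
    by (simp add: algebra_simps)
  also have "\<dots> = u *\<^sub>R x + v *\<^sub>R y + C" using uv(3) by simp
  finally show "u * f (x + C) + v * f (y + C) \<le> f (u *\<^sub>R x + v *\<^sub>R y + C)" .
qed simp

lemma concave_on_reflect:
  fixes h :: "real \<Rightarrow> real"
  assumes "concave_on UNIV h"
  shows "concave_on UNIV (\<lambda>z. h (- z))"
  unfolding concave_on_iff
proof (intro conjI ballI allI impI)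
  fix x y u v :: real assume "0 \<le> u" "0 \<le> v" "u + v = 1"
  then have "u * h (- x) + v * h (- y) \<le> h (u *\<^sub>R (- x) + v *\<^sub>R (- y))"
    using assms unfolding concave_on_iff by blast
  then show "u * h (- x) + v * h (- y) \<le> h (- (u *\<^sub>R x + v *\<^sub>R y))" by simp
qed simp

lemma concave_on_cong:
  assumes "\<And>x. x \<in> S \<Longrightarrow> f x = h x" "concave_on S h"
  shows "concave_on S f"
  using assms(2) assms(1) convexD[of S] by (simp add: concave_on_iff)

lemma concave_on_UNIV_subset:
  fixes h :: "real \<Rightarrow> real"
  assumes "concave_on UNIV h" "convex S"
  shows "concave_on S h"
  using assms by (simp add: concave_on_iff)

lemma concave_on_UNIV_continuous:
  fixes h :: "real \<Rightarrow> real"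
  assumes "concave_on UNIV h"
  shows "continuous_on S h"
proof -
  have "continuous_on UNIV (\<lambda>x. - h x)"
    by (rule convex_on_continuous) (use assms in \<open>simp_all add: concave_on_def\<close>)
  from continuous_on_minus[OF this] show ?thesis by (auto intro: continuous_on_subset)
qed

lemma concave_on_sum_functions:
  assumes "finite I" "convex S" "\<And>i. i \<in> I \<Longrightarrow> concave_on S (f i)"
  shows "concave_on S (\<lambda>x. \<Sum>i\<in>I. f i x)"
  using assms(1,3)
  by (induction I) (simp_all add: concave_on_add concave_on_const assms(2))

text \<open>The maximum with a constant is convex, and a decreasing concave function of a convex one is
  concave. This is how the level of a class enters after a matching decision.\<close>

lemma concave_on_antimono_max:
  fixes h :: "real \<Rightarrow> real"
  assumes h: "concave_on UNIV h" and anti: "antimono h"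
  shows "concave_on UNIV (\<lambda>a. h (max a q))"
  unfolding concave_on_iff
proof (intro conjI ballI allI impI)
  fix x y u v :: real assume uv: "0 \<le> u" "0 \<le> v" "u + v = 1"
  have q: "q = u * q + v * q" using uv by (metis distrib_right mult_1)
  have "max (u * x + v * y) q \<le> u * max x q + v * max y q"
    using uv by (subst (1) q) (auto intro!: add_mono mult_left_mono)
  then have "h (u * max x q + v * max y q) \<le> h (max (u * x + v * y) q)"
    using anti by (simp add: antimono_def)
  moreover have "u * h (max x q) + v * h (max y q) \<le> h (u * max x q + v * max y q)"
    using h uv by (simp add: concave_on_iff)
  ultimately show "u * h (max x q) + v * h (max y q) \<le> h (max (u *\<^sub>R x + v *\<^sub>R y) q)" by simp
qed simp

text \<open>Concavity with the denominator cleared: the middle point lies above the chord.\<close>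

lemma concave_on_chord:
  fixes h :: "real \<Rightarrow> real"
  assumes "concave_on S h" "x \<in> S" "z \<in> S" "x < y" "y < z"
  shows "(z - y) * h x + (y - x) * h z \<le> (z - x) * h y"
proof -
  define u v where "u = (z - y) / (z - x)" and "v = (y - x) / (z - x)"
  have zx: "z - x > 0" using assms by simp
  have uv: "0 \<le> u" "0 \<le> v" "u + v = 1" "(z - x) * u = z - y" "(z - x) * v = y - x"
    using assms by (auto simp: u_def v_def add_divide_distrib[symmetric])
  have "(z - x) * (u * x + v * z) = (z - y) * x + (y - x) * z"
    using uv(4,5) by (metis distrib_left mult.assoc)
  also have "\<dots> = (z - x) * y" by (simp add: algebra_simps)
  finally have y: "u * x + v * z = y" using zx by simp
  have "u * h x + v * h z \<le> h (u * x + v * z)"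
    using assms(1-3) uv(1-3) by (simp add: concave_on_iff)
  then have "(z - x) * (u * h x + v * h z) \<le> (z - x) * h y"
    unfolding y using zx by (intro mult_left_mono) auto
  then show ?thesis using uv(4,5) by (metis distrib_left mult.assoc)
qed

lemma concave_on_decrease_persists:
  fixes h :: "real \<Rightarrow> real"
  assumes "concave_on S h" "x \<in> S" "z \<in> S" "x < y" "y < z" "h y \<le> h x"
  shows "h z \<le> h y"
proof -
  have "(z - y) * h y \<le> (z - y) * h x" using assms by (intro mult_left_mono) auto
  with concave_on_chord[OF assms(1-5)] have "(y - x) * h z \<le> (y - x) * h y"
    by (simp add: algebra_simps)
  then show ?thesis using assms(4) by simp
qed

text \<open>The chord from \<open>x\<close> to \<open>z\<close> descends, so it lies strictly above \<open>h z\<close> until it reaches \<open>z\<close>.\<close>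

lemma concave_on_drop_is_final:
  fixes h :: "real \<Rightarrow> real"
  assumes "concave_on S h" "x \<in> S" "z \<in> S" "x < y" "y < z" "h z < h x"
  shows "h z < h y"
proof -
  have "(z - y) * h z < (z - y) * h x" using assms by (intro mult_strict_left_mono) auto
  with concave_on_chord[OF assms(1-5)] have "(z - x) * h z < (z - x) * h y"
    by (simp add: algebra_simps)
  then show ?thesis using assms(4,5) by simp
qed

section \<open>Protection levels of concave functions\<close>

text \<open>The least point of \<open>[z\<^sub>0, \<infinity>)\<close> from which \<open>h\<close> never rises again. For concave \<open>h\<close> this is the smallest
  maximizer on that half-line, hence the stopping point of a policy that breaks ties in favour of
  matching. It is \<open>\<infinity>\<close> if \<open>h\<close> keeps rising: then nothing is matched.\<close>

definition protection_level :: "real \<Rightarrow> (real \<Rightarrow> real) \<Rightarrow> ereal" where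
  "protection_level z\<^sub>0 h = Inf {ereal z |z. z\<^sub>0 \<le> z \<and> (\<forall>z'>z. h z' \<le> h z)}"

lemma protection_level_le:
  "z\<^sub>0 \<le> z \<Longrightarrow> (\<And>z'. z' > z \<Longrightarrow> h z' \<le> h z) \<Longrightarrow> protection_level z\<^sub>0 h \<le> ereal z"
  unfolding protection_level_def by (rule Inf_lower) auto

lemma protection_level_ge: "ereal z\<^sub>0 \<le> protection_level z\<^sub>0 h"
  unfolding protection_level_def by (rule Inf_greatest) auto

lemma above_protection_level:
  assumes h: "concave_on UNIV h" and z: "protection_level z\<^sub>0 h < ereal z" "z < z'"
  shows "h z' \<le> h z"
proof -
  obtain a where a: "ereal a < ereal z" "\<forall>z'>a. h z' \<le> h a"
    using z(1) unfolding protection_level_def Inf_less_iff by auto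
  then show ?thesis using concave_on_decrease_persists[OF h, of a z' z] z(2) by simp
qed

text \<open>Wherever \<open>k\<close> does not rise beyond \<open>z\<close>, the increments of \<open>h\<close> at distance \<open>d\<close> further are no larger, so
  \<open>h\<close> does not rise beyond \<open>z + d\<close>. With \<open>d = 0\<close> this gives monotonicity of protection levels, with \<open>d\<close>
  the change of the imbalance it gives the bound on their rate.\<close>

lemma protection_level_mono:
  assumes "z\<^sub>0 \<le> z\<^sub>1 + d"
    and "\<And>z z'. z \<le> z' \<Longrightarrow> h (z' + d) - h (z + d) \<le> k z' - k z"
  shows "protection_level z\<^sub>0 h \<le> protection_level z\<^sub>1 k + ereal d"
proof -
  have "protection_level z\<^sub>0 h - ereal d \<le> protection_level z\<^sub>1 k"
    unfolding protection_level_def[of z\<^sub>1]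
  proof (rule Inf_greatest, clarify)
    fix z assume z: "z\<^sub>1 \<le> z" "\<forall>z'>z. k z' \<le> k z"
    have "h z' \<le> h (z + d)" if "z' > z + d" for z'
    proof -
      have "h (z' - d + d) - h (z + d) \<le> k (z' - d) - k z" by (rule assms(2)) (use that in simp)
      also have "k (z' - d) \<le> k z" using z(2) that by simp
      finally show ?thesis by simp
    qed
    then have "protection_level z\<^sub>0 h \<le> ereal (z + d)"
      using z(1) assms(1) by (intro protection_level_le) auto
    then show "protection_level z\<^sub>0 h - ereal d \<le> ereal z"
      by (simp add: ereal_minus_le)
  qed
  then show ?thesis by (simp add: ereal_minus_le)
qed

text \<open>Two numbers have the same projection to \<open>[L, M]\<close> if no point of \<open>(L, M]\<close> separates them.\<close>

lemma clamp_eqI: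
  fixes L M q r :: real
  assumes "L \<le> M"
    and "\<And>Q. L < Q \<Longrightarrow> Q \<le> M \<Longrightarrow> Q < r \<Longrightarrow> Q \<le> q"
    and "\<And>Q. L < Q \<Longrightarrow> Q \<le> M \<Longrightarrow> r < Q \<Longrightarrow> q < Q"
  shows "max 0 (min M q - L) = min (M - L) (max 0 (r - L))"
proof -
  let ?c = "max L (min M q)" and ?d = "max L (min M r)"
  have "?c = ?d"
  proof (rule ccontr)
    assume "?c \<noteq> ?d"
    then consider "?c < ?d" | "?d < ?c" by linarith
    then show False
    proof cases
      case 1
      then obtain Q where "?c < Q" "Q < ?d" using dense by blast
      then have "L < Q" "Q < M" "Q < r" by (auto simp: less_max_iff_disj)
      then show False using assms(2)[of Q] \<open>?c < Q\<close> by auto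
    next
      case 2
      then obtain Q where "?d < Q" "Q < ?c" using dense by blast
      then have "L < Q" "Q < M" "r < Q" "Q < q" by (auto simp: less_max_iff_disj)
      then show False using assms(3)[of Q] by auto
    qed
  qed
  then show ?thesis using assms(1) by (auto simp: min_def max_def split: if_splits)
qed

section \<open>Greedy reward of one quality class\<close>

text \<open>In all three definitions \<open>f a z w\<close> is the reward of a class of level \<open>a\<close> when the total demand is \<open>z\<close>
  and the total supply is \<open>w\<close>, and \<open>g\<close> is what it earns per unit in the first period. Matching \<open>s\<close> of
  its units beforehand takes them out of the class and out of both totals, and forgoes the reward
  \<open>g * s\<close> in every state.\<close>

definition shift_covariant :: "real \<Rightarrow> (real \<Rightarrow> real \<Rightarrow> real \<Rightarrow> real) \<Rightarrow> bool" where
  "shift_covariant g f \<longleftrightarrow> (\<forall>a z w s. f (a - s) (z - s) (w - s) = f a z w - g * s)"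

definition lipschitz3 :: "real \<Rightarrow> (real \<Rightarrow> real \<Rightarrow> real \<Rightarrow> real) \<Rightarrow> bool" where
  "lipschitz3 B f \<longleftrightarrow> 0 \<le> B \<and>
     (\<forall>a z w a' z' w'. \<bar>f a z w - f a' z' w'\<bar> \<le> B * (\<bar>a - a'\<bar> + \<bar>z - z'\<bar> + \<bar>w - w'\<bar>))"

text \<open>The last conjunct says that \<open>f\<close> has increasing differences in the level and each of the two totals.\<close>

definition diminishing :: "real \<Rightarrow> (real \<Rightarrow> real \<Rightarrow> real \<Rightarrow> real) \<Rightarrow> bool" where
  "diminishing g f \<longleftrightarrow>
     (\<forall>z w. concave_on UNIV (\<lambda>a. f a z w)) \<and>
     (\<forall>a a' z w. a \<le> a' \<longrightarrow> 0 \<le> f a' z w - f a z w \<and> f a' z w - f a z w \<le> g * (a' - a)) \<and>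
     (\<forall>a a' z z' w w'. a \<le> a' \<longrightarrow> z \<le> z' \<longrightarrow> w \<le> w' \<longrightarrow>
        f a' z w - f a z w \<le> f a' z' w' - f a z' w')"

lemma shift_covariantD: "shift_covariant g f \<Longrightarrow> f (a - s) (z - s) (w - s) = f a z w - g * s"
  by (simp add: shift_covariant_def)

lemma lipschitz3D:
  "lipschitz3 B f \<Longrightarrow> \<bar>f a z w - f a' z' w'\<bar> \<le> B * (\<bar>a - a'\<bar> + \<bar>z - z'\<bar> + \<bar>w - w'\<bar>)"
  by (simp add: lipschitz3_def)

lemma
  assumes "diminishing g f"
  shows diminishing_concave: "concave_on UNIV (\<lambda>a. f a z w)"
    and diminishing_mono: "a \<le> a' \<Longrightarrow> f a z w \<le> f a' z w"
    and diminishing_slope: "a \<le> a' \<Longrightarrow> f a' z w - f a z w \<le> g * (a' - a)"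
    and diminishing_differences: "a \<le> a' \<Longrightarrow> z \<le> z' \<Longrightarrow> w \<le> w' \<Longrightarrow>
          f a' z w - f a z w \<le> f a' z' w' - f a z' w'"
proof -
  note * = assms[unfolded diminishing_def]
  show "concave_on UNIV (\<lambda>a. f a z w)" by (rule *[THEN conjunct1, rule_format])
  have slope: "a \<le> a' \<Longrightarrow> 0 \<le> f a' z w - f a z w \<and> f a' z w - f a z w \<le> g * (a' - a)"
    by (rule *[THEN conjunct2, THEN conjunct1, rule_format])
  then show "a \<le> a' \<Longrightarrow> f a z w \<le> f a' z w" by simp
  show "a \<le> a' \<Longrightarrow> f a' z w - f a z w \<le> g * (a' - a)" using slope by blast
  show "a \<le> a' \<Longrightarrow> z \<le> z' \<Longrightarrow> w \<le> w' \<Longrightarrow> f a' z w - f a z w \<le> f a' z' w' - f a z' w'"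
    by (rule *[THEN conjunct2, THEN conjunct2, rule_format])
qed

text \<open>One greedy period of a class that earns \<open>d\<close> per unit: \<open>min z w\<close> units are matched in total, those of
  the class first, and then \<open>C\<close>, \<open>A\<close> and \<open>B\<close> arrive in the class, in total demand and in total supply. The
  formula is the same for demand and supply classes.\<close>

definition serve ::
    "real \<Rightarrow> real \<Rightarrow> real \<Rightarrow> real \<Rightarrow> (real \<Rightarrow> real \<Rightarrow> real \<Rightarrow> real) \<Rightarrow> real \<Rightarrow> real \<Rightarrow> real \<Rightarrow> real" where
  "serve d C A B f a z w =
     d * min a (min z w) +
     f (max (a - min z w) 0 + C) (z - min z w + A) (w - min z w + B)"

text \<open>The state after the first greedy period is the same whether or not \<open>s\<close> units of the class were
  removed before, since the greedy total is reduced by the same \<open>s\<close>.\<close>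

lemma shift_covariant_serve: "shift_covariant d (serve d C A B f)"
  unfolding shift_covariant_def
proof (intro allI)
  fix a z w s :: real
  have 1: "min (z - s) (w - s) = min z w - s"
    and 2: "min (a - s) (min z w - s) = min a (min z w) - s" by auto
  show "serve d C A B f (a - s) (z - s) (w - s) = serve d C A B f a z w - d * s"
    unfolding serve_def 1 2 by (simp add: right_diff_distrib)
qed

lemma lipschitz3_serve:
  assumes "lipschitz3 K f"
  shows "lipschitz3 (\<bar>d\<bar> + 5 * K) (serve d C A B f)"
  unfolding lipschitz3_def
proof (intro conjI allI)
  have K: "0 \<le> K" using assms by (simp add: lipschitz3_def)
  then show "0 \<le> \<bar>d\<bar> + 5 * K" by simp
  fix a z w a' z' w' :: real
  let ?s = "\<bar>a - a'\<bar> + \<bar>z - z'\<bar> + \<bar>w - w'\<bar>"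
  define q q' where "q = min z w" and "q' = min z' w'"
  have q: "\<bar>q - q'\<bar> \<le> \<bar>z - z'\<bar> + \<bar>w - w'\<bar>" unfolding q_def q'_def by linarith
  have 1: "\<bar>d * min a q - d * min a' q'\<bar> \<le> \<bar>d\<bar> * ?s"
  proof -
    have "\<bar>min a q - min a' q'\<bar> \<le> ?s" using q by linarith
    then show ?thesis
      by (metis abs_ge_zero abs_mult mult_left_mono right_diff_distrib)
  qed
  have "\<bar>f (max (a - q) 0 + C) (z - q + A) (w - q + B)
        - f (max (a' - q') 0 + C) (z' - q' + A) (w' - q' + B)\<bar>
     \<le> K * (\<bar>max (a - q) 0 + C - (max (a' - q') 0 + C)\<bar> + \<bar>z - q + A - (z' - q' + A)\<bar>
          + \<bar>w - q + B - (w' - q' + B)\<bar>)"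
    by (rule lipschitz3D[OF assms])
  also have "\<dots> \<le> K * (5 * ?s)"
  proof (intro mult_left_mono K)
    have sum: "X + Y + Z \<le> 5 * (u + v + t)"
      if "X \<le> u + p" "Y \<le> v + p" "Z \<le> t + p" "p \<le> v + t" "0 \<le> u" "0 \<le> v" "0 \<le> t"
      for X Y Z u v t p :: real
      using that by simp
    have "\<bar>max (a - q) 0 + C - (max (a' - q') 0 + C)\<bar> \<le> \<bar>a - a'\<bar> + \<bar>q - q'\<bar>"
      "\<bar>z - q + A - (z' - q' + A)\<bar> \<le> \<bar>z - z'\<bar> + \<bar>q - q'\<bar>"
      "\<bar>w - q + B - (w' - q' + B)\<bar> \<le> \<bar>w - w'\<bar> + \<bar>q - q'\<bar>" by linarith+
    from sum[OF this q]
    show "\<bar>max (a - q) 0 + C - (max (a' - q') 0 + C)\<bar> + \<bar>z - q + A - (z' - q' + A)\<bar>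
          + \<bar>w - q + B - (w' - q' + B)\<bar> \<le> 5 * ?s" by simp
  qed
  also have "K * (5 * ?s) = 5 * K * ?s" by simp
  finally show "\<bar>serve d C A B f a z w - serve d C A B f a' z' w'\<bar> \<le> (\<bar>d\<bar> + 5 * K) * ?s"
    unfolding serve_def q_def[symmetric] q'_def[symmetric] add_diff_add distrib_right[of "\<bar>d\<bar>"]
    by (rule order_trans[OF abs_triangle_ineq add_mono[OF 1]])
qed

lemma shift_covariant_translate:
  assumes "shift_covariant g f"
  shows "shift_covariant g (\<lambda>a z w. f (a + C) (z + A) (w + B))"
  unfolding shift_covariant_def diff_add_eq by (intro allI shift_covariantD[OF assms])

lemma lipschitz3_translate:
  assumes "lipschitz3 K f"
  shows "lipschitz3 K (\<lambda>a z w. f (a + C) (z + A) (w + B))"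
proof -
  have "\<bar>f (a + C) (z + A) (w + B) - f (a' + C) (z' + A) (w' + B)\<bar>
      \<le> K * (\<bar>a - a'\<bar> + \<bar>z - z'\<bar> + \<bar>w - w'\<bar>)" for a z w a' z' w'
    using lipschitz3D[OF assms, of "a + C" "z + A" "w + B" "a' + C" "z' + A" "w' + B"] by simp
  then show ?thesis using assms by (simp add: lipschitz3_def)
qed

lemma diminishing_translate:
  assumes f: "diminishing g f"
  shows "diminishing g (\<lambda>a z w. f (a + C) (z + A) (w + B))"
  unfolding diminishing_def
proof (intro conjI allI impI)
  fix z w
  show "concave_on UNIV (\<lambda>a. f (a + C) (z + A) (w + B))"
    by (rule concave_on_translate[OF diminishing_concave[OF f]])
next
  fix a a' z w :: real assume "a \<le> a'"
  then show "0 \<le> f (a' + C) (z + A) (w + B) - f (a + C) (z + A) (w + B)"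
    and "f (a' + C) (z + A) (w + B) - f (a + C) (z + A) (w + B) \<le> g * (a' - a)"
    using diminishing_mono[OF f, of "a + C" "a' + C"] diminishing_slope[OF f, of "a + C" "a' + C"]
    by simp_all
next
  fix a a' z z' w w' :: real assume "a \<le> a'" "z \<le> z'" "w \<le> w'"
  then show "f (a' + C) (z + A) (w + B) - f (a + C) (z + A) (w + B)
      \<le> f (a' + C) (z' + A) (w' + B) - f (a + C) (z' + A) (w' + B)"
    by (intro diminishing_differences[OF f]) auto
qed

lemma concave_on_waiting_loss:
  assumes f: "diminishing g f"
  shows "concave_on UNIV (\<lambda>e. f e z w - d * e)"
  using concave_on_affine_plus[OF diminishing_concave[OF f, of z w], of "- d" 0] by simp

text \<open>Carrying a unit of the class over to the next period instead of matching it at once gains at most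
  \<open>g\<close> and gives up \<open>d \<ge> g\<close>.\<close>

lemma antimono_waiting_loss:
  assumes f: "diminishing g f" and gd: "g \<le> d"
  shows "antimono (\<lambda>e. f e z w - d * e)"
proof (rule antimonoI)
  fix e e' :: real assume e: "e \<le> e'"
  have "f e' z w - f e z w \<le> g * (e' - e)" by (rule diminishing_slope[OF f e])
  also have "\<dots> \<le> d * (e' - e)" using gd e by (intro mult_right_mono) auto
  finally show "f e' z w - d * e' \<le> f e z w - d * e" by (simp add: algebra_simps)
qed

text \<open>With \<open>q = min z w\<close> and \<open>min a q = a + q - max a q\<close>, shift covariance rewrites \<open>serve\<close> as \<open>h (max a q)\<close>
  plus a linear function of \<open>a\<close> and \<open>q\<close>, where \<open>h\<close> is the concave decreasing waiting loss. So concavity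
  in \<open>a\<close> is preserved. Raising \<open>z\<close> or \<open>w\<close> can only raise the threshold \<open>q\<close> below which additional units of
  the class are matched at once at the full gap \<open>d\<close>, and the increments of \<open>h\<close> beyond it.\<close>

lemma diminishing_serve:
  assumes sh: "shift_covariant g f" and f: "diminishing g f" and gd: "0 \<le> g" "g \<le> d"
  shows "diminishing d (serve d C A B f)"
proof -
  define h where "h z w e = f (e + C) (z + A) (w + B) - d * e" for z w e
  have serve: "serve d C A B f a z w =
      h z w (max a (min z w)) + (d * a + (d - g) * min z w)" for a z w
  proof -
    let ?q = "min z w"
    have "f (max (a - ?q) 0 + C) (z - ?q + A) (w - ?q + B)
        = f (max a ?q + C - ?q) (z + A - ?q) (w + B - ?q)"
      by (rule arg_cong3[where f = f]) auto
    also have "\<dots> = f (max a ?q + C) (z + A) (w + B) - g * ?q"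
      by (rule shift_covariantD[OF sh])
    finally have *: "f (max (a - ?q) 0 + C) (z - ?q + A) (w - ?q + B)
        = f (max a ?q + C) (z + A) (w + B) - g * ?q" .
    have "min a ?q = a + ?q - max a ?q" by auto
    then have "d * min a ?q = d * a + d * ?q - d * max a ?q"
      by (simp only: right_diff_distrib distrib_left)
    then show ?thesis unfolding serve_def h_def * by (simp add: left_diff_distrib)
  qed
  note f' = diminishing_translate[OF f, of C A B]
  have h_anti: "h z w e' \<le> h z w e" if "e \<le> e'" for z w e e'
    unfolding h_def by (rule antimonoD[OF antimono_waiting_loss[OF f' gd(2)] that])
  have h_mono: "h z w e' - h z w e + d * (e' - e) \<ge> 0" if "e \<le> e'" for z w e e'
    using diminishing_mono[OF f' that, of z w] by (simp add: h_def right_diff_distrib)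
  have h_diff: "h z w e' - h z w e \<le> h z' w' e' - h z' w' e"
    if "e \<le> e'" "z \<le> z'" "w \<le> w'" for z w z' w' e e'
    using diminishing_differences[OF f' that] by (simp add: h_def)
  have h_conc: "concave_on UNIV (h z w)" for z w
    unfolding h_def[abs_def] by (rule concave_on_waiting_loss[OF f'])
  show ?thesis
    unfolding diminishing_def
  proof (intro conjI allI impI)
    fix z w
    have "concave_on UNIV (\<lambda>a. h z w (max a (min z w)))"
      by (rule concave_on_antimono_max[OF h_conc]) (simp add: antimono_def h_anti)
    from concave_on_affine_plus[OF this]
    show "concave_on UNIV (\<lambda>a. serve d C A B f a z w)" unfolding serve .
  next
    fix a a' z w :: real assume a: "a \<le> a'"
    then have m: "max a (min z w) \<le> max a' (min z w)" by linarith
    have "max a' (min z w) - max a (min z w) \<le> a' - a" using a by linarith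
    then have "d * (max a' (min z w) - max a (min z w)) \<le> d * (a' - a)"
      using gd by (intro mult_left_mono) auto
    then show "0 \<le> serve d C A B f a' z w - serve d C A B f a z w"
      unfolding serve using h_mono[OF m, of z w] by (simp add: algebra_simps)
    show "serve d C A B f a' z w - serve d C A B f a z w \<le> d * (a' - a)"
      unfolding serve using h_anti[OF m, of z w] by (simp add: algebra_simps)
  next
    fix a a' z z' w w' :: real assume a: "a \<le> a'" and zw: "z \<le> z'" "w \<le> w'"
    define q q' where "q = min z w" and "q' = min z' w'"
    have q: "q \<le> q'" using zw by (auto simp: q_def q'_def)
    have "h z w (max a' q) - h z w (max a q) \<le> h z' w' (max a' q') - h z' w' (max a q')"
    \<comment> \<open>If \<open>a' \<le> q'\<close> the larger system serves both levels fully, and the waiting losses agree.\<close>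
    proof (cases "a' \<le> q'")
      case True
      then have "max a' q' = max a q'" using a by simp
      then show ?thesis using h_anti[of "max a q" "max a' q" z w] a by simp
    next
      case False
      then have *: "max a' q = a'" "max a' q' = a'" "max a q \<le> a'" using q a by auto
      have "h z w a' - h z w (max a q) \<le> h z' w' a' - h z' w' (max a q)"
        by (rule h_diff) (use * zw in auto)
      moreover have "h z' w' (max a q') \<le> h z' w' (max a q)"
        by (rule h_anti) (use q in auto)
      ultimately show ?thesis using * by simp
    qed
    then show "serve d C A B f a' z w - serve d C A B f a z w
        \<le> serve d C A B f a' z' w' - serve d C A B f a z' w'"
      unfolding serve q_def[symmetric] q'_def[symmetric] by simp
  qed
qed

text \<open>Reward of a class under the greedy policy in \<open>k\<close> periods, the first being \<open>t\<close>; \<open>d\<close> are the quality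
  gaps and \<open>C\<close>, \<open>A\<close>, \<open>B\<close> the arrivals by period.\<close>

primrec class_reward ::
    "(nat \<Rightarrow> real) \<Rightarrow> (nat \<Rightarrow> real) \<Rightarrow> (nat \<Rightarrow> real) \<Rightarrow> (nat \<Rightarrow> real) \<Rightarrow> nat \<Rightarrow> nat \<Rightarrow>
     real \<Rightarrow> real \<Rightarrow> real \<Rightarrow> real" where
  "class_reward d C A B 0 t = (\<lambda>a z w. 0)"
| "class_reward d C A B (Suc k) t =
     serve (d t) (C (t + 1)) (A (t + 1)) (B (t + 1)) (class_reward d C A B k (t + 1))"

lemma shift_covariant_class_reward:
  "shift_covariant (if k = 0 then 0 else d t) (class_reward d C A B k t)"
  by (cases k) (simp_all add: shift_covariant_serve, simp add: shift_covariant_def)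

text \<open>The constant is uniform in the arrivals. This makes differences of rewards between two states
  bounded random variables.\<close>

lemma lipschitz3_class_reward:
  "\<exists>K. \<forall>C A B. lipschitz3 K (class_reward d C A B k t)"
proof (induction k arbitrary: t)
  case 0
  have "lipschitz3 0 (\<lambda>a z w. 0)" by (simp add: lipschitz3_def)
  then show ?case by auto
next
  case (Suc k)
  then show ?case using lipschitz3_serve by (metis class_reward.simps(2))
qed

lemma diminishing_class_reward:
  assumes "\<And>s. s \<in> {t..<t + k} \<Longrightarrow> 0 \<le> d s"
    and "\<And>s. s \<in> {t..<t + k} \<Longrightarrow> s + 1 < t + k \<Longrightarrow> d (s + 1) \<le> d s"
  shows "diminishing (if k = 0 then 0 else d t) (class_reward d C A B k t)"
  using assms
proof (induction k arbitrary: t)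
  case 0
  then show ?case by (simp add: diminishing_def concave_on_iff)
next
  case (Suc k)
  let ?g = "if k = 0 then 0 else d (t + 1)"
  have "diminishing ?g (class_reward d C A B k (t + 1))"
    by (rule Suc.IH) (use Suc.prems in auto)
  moreover have "0 \<le> ?g" "?g \<le> d t" using Suc.prems(1)[of t] Suc.prems(1)[of "t + 1"] Suc.prems(2)[of t]
    by auto
  ultimately show ?case
    using diminishing_serve[OF shift_covariant_class_reward, of k d "t + 1" "C" A B "d t"
        "C (t + 1)" "A (t + 1)" "B (t + 1)"] by simp
qed

lemma measurable_class_reward:
  assumes "\<And>s. s \<in> {t<..<t + k} \<Longrightarrow> (\<lambda>\<omega>. C \<omega> s) \<in> borel_measurable M"
    and "\<And>s. s \<in> {t<..<t + k} \<Longrightarrow> (\<lambda>\<omega>. A \<omega> s) \<in> borel_measurable M"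
    and "\<And>s. s \<in> {t<..<t + k} \<Longrightarrow> (\<lambda>\<omega>. B \<omega> s) \<in> borel_measurable M"
    and "a \<in> borel_measurable M" "z \<in> borel_measurable M" "w \<in> borel_measurable M"
  shows "(\<lambda>\<omega>. class_reward d (C \<omega>) (A \<omega>) (B \<omega>) k t (a \<omega>) (z \<omega>) (w \<omega>)) \<in> borel_measurable M"
  using assms
proof (induction k arbitrary: t a z w)
  case 0
  then show ?case by simp
next
  case (Suc k)
  note [measurable] = Suc.prems(4-6)
  show ?case
  proof (cases "k = 0")
    case True
    then show ?thesis by (simp add: serve_def)
  next
    case False
    have [measurable]: "(\<lambda>\<omega>. C \<omega> (Suc t)) \<in> borel_measurable M"
      "(\<lambda>\<omega>. A \<omega> (Suc t)) \<in> borel_measurable M" "(\<lambda>\<omega>. B \<omega> (Suc t)) \<in> borel_measurable M"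
      using Suc.prems(1-3)[of "Suc t"] False by auto
    have "(\<lambda>\<omega>. class_reward d (C \<omega>) (A \<omega>) (B \<omega>) k (t + 1)
        (max (a \<omega> - min (z \<omega>) (w \<omega>)) 0 + C \<omega> (Suc t)) (z \<omega> - min (z \<omega>) (w \<omega>) + A \<omega> (Suc t))
        (w \<omega> - min (z \<omega>) (w \<omega>) + B \<omega> (Suc t))) \<in> borel_measurable M"
      by (rule Suc.IH) (use Suc.prems(1-3) in auto)
    then show ?thesis
      unfolding class_reward.simps serve_def Suc_eq_plus1[symmetric]
      by (intro borel_measurable_add) auto
  qed
qed

lemma lipschitz3_measurable:
  assumes f: "lipschitz3 K f"
    and [measurable]: "a \<in> borel_measurable M" "z \<in> borel_measurable M" "w \<in> borel_measurable M"
  shows "(\<lambda>\<omega>. f (a \<omega>) (z \<omega>) (w \<omega>)) \<in> borel_measurable M"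
proof -
  let ?f = "\<lambda>p::real \<times> real \<times> real. f (fst p) (fst (snd p)) (snd (snd p))"
  have "continuous_on UNIV ?f"
    unfolding continuous_on_def
  proof (intro ballI)
    fix p :: "real \<times> real \<times> real"
    let ?e = "\<lambda>x. K * (\<bar>fst x - fst p\<bar> + \<bar>fst (snd x) - fst (snd p)\<bar> + \<bar>snd (snd x) - snd (snd p)\<bar>)"
    have "(?e \<longlongrightarrow> K * (\<bar>fst p - fst p\<bar> + \<bar>fst (snd p) - fst (snd p)\<bar> + \<bar>snd (snd p) - snd (snd p)\<bar>))
        (at p within UNIV)"
      by (intro tendsto_intros)
    then have "(?e \<longlongrightarrow> 0) (at p within UNIV)" by simp
    then have "((\<lambda>x. ?f x - ?f p) \<longlongrightarrow> 0) (at p within UNIV)"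
      by (rule Lim_null_comparison[rotated]) (simp add: lipschitz3D[OF f])
    then show "(?f \<longlongrightarrow> ?f p) (at p within UNIV)" by (simp add: LIM_zero_iff)
  qed
  then have "?f \<in> borel_measurable borel" by (rule borel_measurable_continuous_onI)
  then have "(\<lambda>\<omega>. ?f (a \<omega>, z \<omega>, w \<omega>)) \<in> borel_measurable M"
    by (rule measurable_compose[rotated]) (simp add: borel_prod[symmetric])
  then show ?thesis by simp
qed

text \<open>The contribution of a class to the one-step-ahead objective as a function of the total \<open>Q\<close>: \<open>min a Q\<close>
  units earn \<open>d\<close> now, and shift covariance reduces the rest to the reward of level \<open>max a Q\<close>, less
  \<open>g Q\<close>. Concavity holds for the same reason as in \<open>diminishing_serve\<close>.\<close>

lemma concave_on_class_term:
  assumes f: "diminishing g f" and gd: "g \<le> d"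
  shows "concave_on UNIV (\<lambda>Q. d * min a Q - g * Q + f (max a Q) z w)"
proof -
  have "concave_on UNIV (\<lambda>Q. f (max Q a) z w - d * max Q a)"
    by (rule concave_on_antimono_max[OF concave_on_waiting_loss[OF f] antimono_waiting_loss[OF f gd]])
  from concave_on_affine_plus[OF this, of "d - g" "d * a"]
  have *: "concave_on UNIV (\<lambda>Q. f (max Q a) z w - d * max Q a + ((d - g) * Q + d * a))" .
  have "d * min a Q - g * Q + f (max a Q) z w
      = f (max Q a) z w - d * max Q a + ((d - g) * Q + d * a)" for Q
  proof -
    have "min a Q = a + Q - max Q a" by auto
    then have "d * min a Q = d * a + d * Q - d * max Q a"
      by (simp only: right_diff_distrib distrib_left)
    then show ?thesis by (simp add: max.commute[of a] left_diff_distrib)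
  qed
  then show ?thesis using * by simp
qed

section \<open>Averaging class rewards over the arrivals\<close>

lemma (in finite_measure) integrable_lipschitz3_difference:
  assumes lip: "\<And>\<omega>. \<omega> \<in> space M \<Longrightarrow> lipschitz3 K (f \<omega>)"
    and meas: "\<And>a z w. (\<lambda>\<omega>. f \<omega> a z w) \<in> borel_measurable M"
  shows "integrable M (\<lambda>\<omega>. f \<omega> a z w - f \<omega> a' z' w')"
proof (rule integrable_const_bound)
  show "AE \<omega> in M. norm (f \<omega> a z w - f \<omega> a' z' w') \<le> K * (\<bar>a - a'\<bar> + \<bar>z - z'\<bar> + \<bar>w - w'\<bar>)"
    using lipschitz3D[OF lip] by (intro AE_I2) simp
qed (use meas in simp)

text \<open>Only the change relative to the empty state is averaged: it is bounded, while \<open>f \<omega> a z w\<close> itself may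
  fail to be integrable.\<close>

definition mean_change ::
    "'w measure \<Rightarrow> ('w \<Rightarrow> real \<Rightarrow> real \<Rightarrow> real \<Rightarrow> real) \<Rightarrow> real \<Rightarrow> real \<Rightarrow> real \<Rightarrow> real" where
  "mean_change M f a z w = (\<integral>\<omega>. f \<omega> a z w - f \<omega> 0 0 0 \<partial>M)"

context prob_space
begin

context
  fixes f :: "'a \<Rightarrow> real \<Rightarrow> real \<Rightarrow> real \<Rightarrow> real" and K :: real
  assumes lip: "\<And>\<omega>. \<omega> \<in> space M \<Longrightarrow> lipschitz3 K (f \<omega>)"
    and meas: "\<And>a z w. (\<lambda>\<omega>. f \<omega> a z w) \<in> borel_measurable M"
begin

lemma mean_change_diff:
  "mean_change M f a z w - mean_change M f a' z' w' = (\<integral>\<omega>. f \<omega> a z w - f \<omega> a' z' w' \<partial>M)"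
  unfolding mean_change_def
  by (subst Bochner_Integration.integral_diff[symmetric])
     (simp_all add: integrable_lipschitz3_difference[OF lip meas])

lemma mean_change_mono:
  assumes "\<And>\<omega>. \<omega> \<in> space M \<Longrightarrow>
     f \<omega> a z w - f \<omega> a' z' w' \<le> f \<omega> b x y - f \<omega> b' x' y'"
  shows "mean_change M f a z w - mean_change M f a' z' w'
     \<le> mean_change M f b x y - mean_change M f b' x' y'"
  unfolding mean_change_diff
  by (intro integral_mono integrable_lipschitz3_difference[OF lip meas] assms)

lemma mean_change_le:
  assumes "\<And>\<omega>. \<omega> \<in> space M \<Longrightarrow> f \<omega> a z w - f \<omega> a' z' w' \<le> c"
  shows "mean_change M f a z w - mean_change M f a' z' w' \<le> c"
  unfolding mean_change_diff
  by (intro integral_le_const integrable_lipschitz3_difference[OF lip meas] AE_I2 assms)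

lemma mean_change_ge:
  assumes "\<And>\<omega>. \<omega> \<in> space M \<Longrightarrow> c \<le> f \<omega> a z w - f \<omega> a' z' w'"
  shows "c \<le> mean_change M f a z w - mean_change M f a' z' w'"
  unfolding mean_change_diff
  by (intro integral_ge_const integrable_lipschitz3_difference[OF lip meas] AE_I2 assms)

lemma lipschitz3_mean_change: "lipschitz3 K (mean_change M f)"
  unfolding lipschitz3_def
proof (intro conjI allI)
  show "0 \<le> K" using lip not_empty by (auto simp: lipschitz3_def)
  fix a z w a' z' w' :: real
  let ?s = "K * (\<bar>a - a'\<bar> + \<bar>z - z'\<bar> + \<bar>w - w'\<bar>)"
  have *: "f \<omega> a z w - f \<omega> a' z' w' \<le> ?s" "- ?s \<le> f \<omega> a z w - f \<omega> a' z' w'" if "\<omega> \<in> space M" for \<omega>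
    using lipschitz3D[OF lip[OF that], of a z w a' z' w'] by linarith+
  show "\<bar>mean_change M f a z w - mean_change M f a' z' w'\<bar> \<le> ?s"
    using mean_change_le[OF *(1)] mean_change_ge[OF *(2)] by (simp add: abs_le_iff)
qed

lemma shift_covariant_mean_change:
  assumes "\<And>\<omega>. \<omega> \<in> space M \<Longrightarrow> shift_covariant g (f \<omega>)"
  shows "shift_covariant g (mean_change M f)"
  unfolding shift_covariant_def
proof (intro allI)
  fix a z w s
  have *: "f \<omega> (a - s) (z - s) (w - s) - f \<omega> a z w = - (g * s)" if "\<omega> \<in> space M" for \<omega>
    using shift_covariantD[OF assms[OF that]] by simp
  have "mean_change M f (a - s) (z - s) (w - s) - mean_change M f a z w = - (g * s)"
    using mean_change_le[OF eq_refl[OF *]] mean_change_ge[OF eq_refl[OF *[symmetric]]] by simp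
  then show "mean_change M f (a - s) (z - s) (w - s) = mean_change M f a z w - g * s" by simp
qed

lemma diminishing_mean_change:
  assumes dim: "\<And>\<omega>. \<omega> \<in> space M \<Longrightarrow> diminishing g (f \<omega>)"
  shows "diminishing g (mean_change M f)"
  unfolding diminishing_def
proof (intro conjI allI impI)
  fix z w
  show "concave_on UNIV (\<lambda>a. mean_change M f a z w)"
    unfolding concave_on_iff
  proof (intro conjI ballI allI impI)
    fix x y u v :: real assume uv: "0 \<le> u" "0 \<le> v" "u + v = 1"
    let ?c = "u *\<^sub>R x + v *\<^sub>R y"
    have "u * (mean_change M f x z w - mean_change M f ?c z w)
        + v * (mean_change M f y z w - mean_change M f ?c z w)
      = (\<integral>\<omega>. u * (f \<omega> x z w - f \<omega> ?c z w) + v * (f \<omega> y z w - f \<omega> ?c z w) \<partial>M)"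
      unfolding mean_change_diff
      by (simp add: integrable_lipschitz3_difference[OF lip meas] del: real_scaleR_def)
    also have "\<dots> \<le> 0"
    proof (rule integral_le_const)
      have "u * (f \<omega> x z w - f \<omega> ?c z w) + v * (f \<omega> y z w - f \<omega> ?c z w) \<le> 0"
        if "\<omega> \<in> space M" for \<omega>
      proof -
        have "u * f \<omega> x z w + v * f \<omega> y z w \<le> f \<omega> ?c z w"
          using diminishing_concave[OF dim[OF that], of z w] uv by (simp add: concave_on_iff)
        also have "\<dots> = u * f \<omega> ?c z w + v * f \<omega> ?c z w"
          using uv by (metis distrib_right mult_1)
        finally show ?thesis by (simp add: right_diff_distrib)
      qed
      then show "AE \<omega> in M. u * (f \<omega> x z w - f \<omega> ?c z w) + v * (f \<omega> y z w - f \<omega> ?c z w) \<le> 0" by simp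
    qed (simp add: integrable_lipschitz3_difference[OF lip meas] del: real_scaleR_def)
    finally have *: "u * (mean_change M f x z w - mean_change M f ?c z w)
        + v * (mean_change M f y z w - mean_change M f ?c z w) \<le> 0" .
    have "u * mean_change M f ?c z w + v * mean_change M f ?c z w = mean_change M f ?c z w"
      using uv by (metis distrib_right mult_1)
    with * show "u * mean_change M f x z w + v * mean_change M f y z w \<le> mean_change M f ?c z w"
      by (simp add: right_diff_distrib)
  qed simp
next
  fix a a' z w :: real assume a: "a \<le> a'"
  show "0 \<le> mean_change M f a' z w - mean_change M f a z w"
    by (rule mean_change_ge) (simp add: diminishing_mono[OF dim] a)
  show "mean_change M f a' z w - mean_change M f a z w \<le> g * (a' - a)"
    by (rule mean_change_le) (rule diminishing_slope[OF dim a])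
next
  fix a a' z z' w w' :: real assume "a \<le> a'" "z \<le> z'" "w \<le> w'"
  then show "mean_change M f a' z w - mean_change M f a z w
      \<le> mean_change M f a' z' w' - mean_change M f a z' w'"
    by (intro mean_change_mono diminishing_differences[OF dim])
qed

end

text \<open>The integrand differs from \<open>base\<close>, which does not depend on the levels, by a bounded function. So its
  integrability does not depend on the levels either, and if it fails the integral is \<open>0\<close> by
  convention.\<close>

lemma expected_class_sum:
  fixes F :: "'k \<Rightarrow> 'a \<Rightarrow> real \<Rightarrow> real \<Rightarrow> real \<Rightarrow> real"
    and c :: real and a :: "'k \<Rightarrow> real"
  assumes "finite I"
    and lip: "\<And>k \<omega>. k \<in> I \<Longrightarrow> \<omega> \<in> space M \<Longrightarrow> lipschitz3 (K k) (F k \<omega>)"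
    and meas: "\<And>k a z w. k \<in> I \<Longrightarrow> (\<lambda>\<omega>. F k \<omega> a z w) \<in> borel_measurable M"
  defines "base \<equiv> \<lambda>\<omega>. c + (\<Sum>k\<in>I. F k \<omega> 0 0 0)"
  shows "(\<integral>\<omega>. c + (\<Sum>k\<in>I. F k \<omega> (a k) z w) \<partial>M)
     = (if integrable M base then (\<integral>\<omega>. base \<omega> \<partial>M) + (\<Sum>k\<in>I. mean_change M (F k) (a k) z w) else 0)"
proof -
  let ?R = "\<lambda>\<omega>. \<Sum>k\<in>I. F k \<omega> (a k) z w - F k \<omega> 0 0 0"
  have eq: "(\<lambda>\<omega>. c + (\<Sum>k\<in>I. F k \<omega> (a k) z w)) = (\<lambda>\<omega>. base \<omega> + ?R \<omega>)"
    by (simp add: base_def sum_subtractf)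
  have R: "integrable M ?R"
    by (intro Bochner_Integration.integrable_sum integrable_lipschitz3_difference[OF lip meas])
  show ?thesis
  proof (cases "integrable M base")
    case True
    then show ?thesis
      unfolding eq using R
      by (simp add: mean_change_def Bochner_Integration.integral_sum
          integrable_lipschitz3_difference[OF lip meas])
  next
    case False
    have "\<not> integrable M (\<lambda>\<omega>. base \<omega> + ?R \<omega>)"
    proof
      assume "integrable M (\<lambda>\<omega>. base \<omega> + ?R \<omega>)"
      from Bochner_Integration.integrable_diff[OF this R] show False using False by simp
    qed
    then show ?thesis unfolding eq using False by (simp add: not_integrable_integral_eq)
  qed
qed

end

section \<open>Top-down matching in cumulative quantities\<close>

text \<open>\<open>Inl i\<close> stands for the demand types \<open>1..i\<close> taken together and \<open>Inr j\<close> for the supply types \<open>1..j\<close>.\<close>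

definition classes :: "'w matching_model \<Rightarrow> (nat + nat) set" where
  "classes P = {1..num_demand P} <+> {1..num_supply P}"

text \<open>All classes except total demand and total supply. The quality gap of these two is \<open>r\<^sub>m\<close> or \<open>r\<^sub>n\<close> itself
  and may be negative, but no feasible \<open>Q\<close> exceeds their levels, so they contribute linearly to the
  objective.\<close>

definition inner_classes :: "'w matching_model \<Rightarrow> (nat + nat) set" where
  "inner_classes P = {1..<num_demand P} <+> {1..<num_supply P}"

definition level :: "state_vec \<Rightarrow> state_vec \<Rightarrow> nat + nat \<Rightarrow> real" where
  "level x y = case_sum (cumul x) (cumul y)"

definition quality_gap ::
    "(nat \<Rightarrow> nat \<Rightarrow> real) \<Rightarrow> (nat \<Rightarrow> nat \<Rightarrow> real) \<Rightarrow> nat \<Rightarrow> nat + nat \<Rightarrow> real" where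
  "quality_gap rd rs t =
     case_sum (\<lambda>i. rd t i - rd t (i + 1)) (\<lambda>j. rs t j - rs t (j + 1))"

definition arrived :: "'w matching_model \<Rightarrow> nat \<Rightarrow> 'w \<Rightarrow> nat + nat \<Rightarrow> real" where
  "arrived P s \<omega> = level (\<lambda>i. new_demand P s i \<omega>) (\<lambda>j. new_supply P s j \<omega>)"

lemma level_simps [simp]: "level x y (Inl i) = cumul x i" "level x y (Inr j) = cumul y j"
  by (simp_all add: level_def)

lemma finite_classes [simp]: "finite (classes P)" by (simp add: classes_def)

lemma inner_classes_subset: "inner_classes P \<subseteq> classes P"
  by (auto simp: classes_def inner_classes_def)

lemma sum_classes:
  "(\<Sum>\<kappa>\<in>classes P. h \<kappa>) = (\<Sum>i=1..num_demand P. h (Inl i)) + (\<Sum>j=1..num_supply P. h (Inr j))"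
  by (simp add: classes_def sum.Plus)

lemma cumul_0 [simp]: "cumul x 0 = 0" by (simp add: cumul_def)

lemma cumul_Suc: "cumul x (Suc k) = cumul x k + x (Suc k)" by (simp add: cumul_def)

lemma cumul_mono:
  assumes "\<And>i. i \<in> {1..m} \<Longrightarrow> 0 \<le> x i" "k \<le> l" "l \<le> m"
  shows "cumul x k \<le> cumul x l"
  unfolding cumul_def using assms by (intro sum_mono2) auto

lemma cumul_nonneg:
  assumes "\<And>i. i \<in> {1..m} \<Longrightarrow> 0 \<le> x i" "k \<le> m"
  shows "0 \<le> cumul x k"
  using cumul_mono[of m x 0 k] assms by simp

lemma cumul_add: "cumul (\<lambda>i. x i + y i) k = cumul x k + cumul y k"
  by (simp add: cumul_def sum.distrib)

text \<open>Top-down quantities are the lengths of the overlaps of demand and supply intervals, cut off at \<open>Q\<close>;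
  adjacent supply intervals \<open>[Y (j - 1), Y j]\<close> glue together.\<close>

lemma sum_interval_overlaps:
  fixes Y :: "nat \<Rightarrow> real"
  assumes "Y 0 = 0" "0 \<le> X'" "\<And>j. j < n \<Longrightarrow> Y j \<le> Y (Suc j)"
  shows "(\<Sum>j=1..n. max 0 (min (min X (Y j)) Q - max X' (Y (j - 1))))
      = max 0 (min (min X (Y n)) Q - X')"
  using assms(3)
proof (induction n)
  case 0
  then show ?case using assms(1,2) by simp
next
  case (Suc n)
  have "Y n \<le> Y (Suc n)" by (rule Suc.prems) simp
  then have "max 0 (min (min X (Y n)) Q - X') + max 0 (min (min X (Y (Suc n))) Q - max X' (Y n))
      = max 0 (min (min X (Y (Suc n))) Q - X')"
    by (auto simp: max_def min_def)
  then show ?case using Suc by simp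
qed

text \<open>Every statement about rows (demand) transfers to columns (supply).\<close>

lemma top_down_transpose: "top_down x y Q i j = top_down y x Q j i"
  by (simp add: top_down_def min.commute max.commute)

lemma top_down_row_sum:
  assumes x: "\<And>i. i \<in> {1..m} \<Longrightarrow> 0 \<le> x i" and y: "\<And>j. j \<in> {1..n} \<Longrightarrow> 0 \<le> y j"
    and i: "i \<in> {1..m}" and Q: "Q \<le> cumul y n"
  shows "(\<Sum>j=1..n. top_down x y Q i j) = min (cumul x i) Q - min (cumul x (i - 1)) Q"
proof -
  have "(\<Sum>j=1..n. top_down x y Q i j)
      = max 0 (min (min (cumul x i) (cumul y n)) Q - cumul x (i - 1))"
    unfolding top_down_def
    by (rule sum_interval_overlaps) (use i cumul_nonneg[of m x] x in \<open>auto simp: cumul_Suc y\<close>)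
  moreover have "cumul x (i - 1) \<le> cumul x i" by (rule cumul_mono[of m]) (use x i in auto)
  ultimately show ?thesis using Q by (auto simp: min_def max_def)
qed

lemma cumul_top_down_remainder:
  assumes x: "\<And>i. i \<in> {1..m} \<Longrightarrow> 0 \<le> x i" and y: "\<And>j. j \<in> {1..n} \<Longrightarrow> 0 \<le> y j"
    and Q: "0 \<le> Q" "Q \<le> cumul y n" and k: "k \<le> m"
  shows "cumul (\<lambda>i. x i - (\<Sum>j=1..n. top_down x y Q i j)) k = max (cumul x k - Q) 0"
  using k
proof (induction k)
  case 0
  then show ?case using Q by simp
next
  case (Suc k)
  then show ?case
    using top_down_row_sum[of m x n y "Suc k" Q, OF x y] Q by (simp add: cumul_Suc)
qed

lemma top_down_remainder_nonneg:
  assumes x: "\<And>i. i \<in> {1..m} \<Longrightarrow> 0 \<le> x i" and y: "\<And>j. j \<in> {1..n} \<Longrightarrow> 0 \<le> y j"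
    and Q: "Q \<le> cumul y n" and i: "i \<in> {1..m}"
  shows "0 \<le> x i - (\<Sum>j=1..n. top_down x y Q i j)"
proof -
  have "cumul x i = cumul x (i - 1) + x i" using i cumul_Suc[of x "i - 1"] by simp
  then show ?thesis using top_down_row_sum[OF x y i Q] x[OF i] by auto
qed

lemma sum_by_parts:
  fixes r X :: "nat \<Rightarrow> real"
  assumes "r (Suc m) * X m = 0" "X 0 = 0"
  shows "(\<Sum>i=1..m. r i * (X i - X (i - 1))) = (\<Sum>i=1..m. (r i - r (i + 1)) * X i)"
proof -
  have "(\<Sum>i=1..m. r i * (X i - X (i - 1))) - (\<Sum>i=1..m. (r i - r (i + 1)) * X i) = r (Suc m) * X m"
    by (induction m) (use assms(2) in \<open>simp_all add: algebra_simps\<close>)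
  then show ?thesis using assms(1) by simp
qed

context
  fixes P :: "'w matching_model" and rd rs :: "nat \<Rightarrow> nat \<Rightarrow> real"
  assumes model: "matching_model P" and vert: "vertical_rewards P rd rs"
    and carry: "carry_demand P = 1" "carry_supply P = 1"
begin

lemma quality_gap_nonneg:
  assumes t: "t \<in> {1..horizon P}" and \<kappa>: "\<kappa> \<in> inner_classes P"
  shows "0 \<le> quality_gap rd rs t \<kappa>"
proof -
  have "\<forall>i\<in>{1..<num_demand P}. rd t (i + 1) < rd t i"
    and "\<forall>j\<in>{1..<num_supply P}. rs t (j + 1) < rs t j"
    using vert t unfolding vertical_rewards_def by blast+
  then show ?thesis
    using \<kappa> unfolding inner_classes_def quality_gap_def by (auto intro: less_imp_le)
qed

lemma quality_gap_decreasing: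
  assumes t: "t \<in> {1..<horizon P}" and \<kappa>: "\<kappa> \<in> classes P"
  shows "quality_gap rd rs (t + 1) \<kappa> \<le> quality_gap rd rs t \<kappa>"
proof -
  have "\<forall>i\<in>{1..num_demand P}.
      carry_demand P * (rd (t + 1) i - rd (t + 1) (i + 1)) \<le> rd t i - rd t (i + 1)"
    and "\<forall>j\<in>{1..num_supply P}.
      carry_supply P * (rs (t + 1) j - rs (t + 1) (j + 1)) \<le> rs t j - rs t (j + 1)"
    using vert t unfolding vertical_rewards_def by blast+
  then show ?thesis
    using \<kappa> carry unfolding classes_def quality_gap_def by auto
qed

text \<open>Demand type \<open>i\<close> receives \<open>min x\<^sub>i Q - min x\<^sub>i\<^sub>-\<^sub>1 Q\<close> in cumulative quantities; summation by parts moves the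
  difference from the quantities to the rewards.\<close>

lemma period_reward_top_down:
  assumes t: "t \<in> {1..horizon P}" and st: "is_state P x y" and Q: "Q \<in> {0..max_total P x y}"
  shows "period_reward P t (top_down x y Q)
      = (\<Sum>\<kappa>\<in>classes P. quality_gap rd rs t \<kappa> * min (level x y \<kappa>) Q)"
proof -
  let ?m = "num_demand P" and ?n = "num_supply P" and ?q = "top_down x y Q"
  have x: "\<And>i. i \<in> {1..?m} \<Longrightarrow> 0 \<le> x i" and y: "\<And>j. j \<in> {1..?n} \<Longrightarrow> 0 \<le> y j"
    using st by (auto simp: is_state_def)
  have Q': "0 \<le> Q" "Q \<le> cumul x ?m" "Q \<le> cumul y ?n" using Q by (auto simp: max_total_def)
  have end0: "rd t (Suc ?m) = 0" "rs t (Suc ?n) = 0"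
    using vert t by (auto simp: vertical_rewards_def)
  have "period_reward P t ?q = (\<Sum>i=1..?m. \<Sum>j=1..?n. (rd t i + rs t j) * ?q i j)"
    unfolding period_reward_def
    by (intro sum.cong refl) (use vert t in \<open>simp add: vertical_rewards_def\<close>)
  also have "\<dots> = (\<Sum>i=1..?m. \<Sum>j=1..?n. rd t i * ?q i j) + (\<Sum>i=1..?m. \<Sum>j=1..?n. rs t j * ?q i j)"
    by (simp add: distrib_right sum.distrib)
  also have "(\<Sum>i=1..?m. \<Sum>j=1..?n. rs t j * ?q i j) = (\<Sum>j=1..?n. \<Sum>i=1..?m. rs t j * top_down y x Q j i)"
    by (subst sum.swap) (simp add: top_down_transpose[of x])
  also have "\<dots> = (\<Sum>j=1..?n. rs t j * (min (cumul y j) Q - min (cumul y (j - 1)) Q))"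
    by (intro sum.cong refl)
       (simp only: sum_distrib_left[symmetric] top_down_row_sum[of ?n y ?m x, OF y x _ Q'(2)])
  also have "\<dots> = (\<Sum>j=1..?n. (rs t j - rs t (j + 1)) * min (cumul y j) Q)"
    by (rule sum_by_parts) (use end0 Q' in auto)
  also have "(\<Sum>i=1..?m. \<Sum>j=1..?n. rd t i * ?q i j)
      = (\<Sum>i=1..?m. rd t i * (min (cumul x i) Q - min (cumul x (i - 1)) Q))"
    by (intro sum.cong refl)
       (simp only: sum_distrib_left[symmetric] top_down_row_sum[of ?m x ?n y, OF x y _ Q'(3)])
  also have "\<dots> = (\<Sum>i=1..?m. (rd t i - rd t (i + 1)) * min (cumul x i) Q)"
    by (rule sum_by_parts) (use end0 Q' in auto)
  finally show ?thesis by (simp add: sum_classes quality_gap_def)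
qed

lemma level_remainder:
  assumes st: "is_state P x y" and Q: "Q \<in> {0..max_total P x y}" and \<kappa>: "\<kappa> \<in> classes P"
  shows "level (\<lambda>i. x i - (\<Sum>j=1..num_supply P. top_down x y Q i j))
               (\<lambda>j. y j - (\<Sum>i=1..num_demand P. top_down x y Q i j)) \<kappa>
      = max (level x y \<kappa> - Q) 0"
proof -
  let ?m = "num_demand P" and ?n = "num_supply P"
  have x: "\<And>i. i \<in> {1..?m} \<Longrightarrow> 0 \<le> x i" and y: "\<And>j. j \<in> {1..?n} \<Longrightarrow> 0 \<le> y j"
    using st by (auto simp: is_state_def)
  have Q': "0 \<le> Q" "Q \<le> cumul x ?m" "Q \<le> cumul y ?n" using Q by (auto simp: max_total_def)
  show ?thesis
    using \<kappa> cumul_top_down_remainder[of ?m x ?n y Q, OF x y Q'(1,3)]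
      cumul_top_down_remainder[of ?n y ?m x Q, OF y x Q'(1,2)]
    unfolding top_down_transpose[of y] by (auto simp: classes_def)
qed

lemma is_state_remainder:
  assumes st: "is_state P x y" and Q: "Q \<in> {0..max_total P x y}"
  shows "is_state P (\<lambda>i. x i - (\<Sum>j=1..num_supply P. top_down x y Q i j))
                    (\<lambda>j. y j - (\<Sum>i=1..num_demand P. top_down x y Q i j))"
proof -
  let ?m = "num_demand P" and ?n = "num_supply P"
  have x: "\<And>i. i \<in> {1..?m} \<Longrightarrow> 0 \<le> x i" and y: "\<And>j. j \<in> {1..?n} \<Longrightarrow> 0 \<le> y j"
    using st by (auto simp: is_state_def)
  have Q': "Q \<le> cumul x ?m" "Q \<le> cumul y ?n" using Q by (auto simp: max_total_def)
  show ?thesis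
    using top_down_remainder_nonneg[of ?m x ?n y Q, OF x y Q'(2)]
      top_down_remainder_nonneg[of ?n y ?m x Q, OF y x Q'(1)]
    unfolding top_down_transpose[of y] by (auto simp: is_state_def)
qed

lemma is_state_arrivals:
  assumes "is_state P x y" "t \<in> {1..horizon P}" "\<omega> \<in> space (prob_measure P)"
  shows "is_state P (\<lambda>i. x i + new_demand P t i \<omega>) (\<lambda>j. y j + new_supply P t j \<omega>)"
  using assms model by (auto simp: is_state_def matching_model_def intro!: add_nonneg_nonneg)

lemma level_arrivals:
  "level (\<lambda>i. x i + new_demand P t i \<omega>) (\<lambda>j. y j + new_supply P t j \<omega>) \<kappa>
     = level x y \<kappa> + arrived P t \<omega> \<kappa>"
  by (simp add: arrived_def level_def cumul_add split: sum.split)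

lemma total_classes: "Inl (num_demand P) \<in> classes P" "Inr (num_supply P) \<in> classes P"
  using model by (auto simp: classes_def matching_model_def)

lemma max_total_level:
  "max_total P x y = min (level x y (Inl (num_demand P))) (level x y (Inr (num_supply P)))"
  by (simp add: max_total_def)

lemma max_total_nonneg: "is_state P x y \<Longrightarrow> 0 \<le> max_total P x y"
  using cumul_nonneg[of "num_demand P" x] cumul_nonneg[of "num_supply P" y]
  by (simp add: max_total_def is_state_def)

definition greedy_class_reward ::
    "nat \<Rightarrow> nat \<Rightarrow> nat + nat \<Rightarrow> 'w \<Rightarrow> real \<Rightarrow> real \<Rightarrow> real \<Rightarrow> real" where
  "greedy_class_reward k t \<kappa> \<omega> =
     class_reward (\<lambda>s. quality_gap rd rs s \<kappa>) (\<lambda>s. arrived P s \<omega> \<kappa>)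
       (\<lambda>s. arrived P s \<omega> (Inl (num_demand P))) (\<lambda>s. arrived P s \<omega> (Inr (num_supply P))) k t"

text \<open>Along a sample path the classes are decoupled: each one sees the others only through the totals of
  demand and supply.\<close>

lemma greedy_path_reward:
  assumes "is_state P x y" "1 \<le> t" "t + k \<le> horizon P + 1" "\<omega> \<in> space (prob_measure P)"
  shows "path_reward P (greedy_policy P) \<omega> k t x y =
    (\<Sum>\<kappa>\<in>classes P. greedy_class_reward k t \<kappa> \<omega> (level x y \<kappa>)
        (level x y (Inl (num_demand P))) (level x y (Inr (num_supply P))))"
  using assms(1-3)
proof (induction k arbitrary: t x y)
  case 0
  then show ?case by (simp add: greedy_class_reward_def)
next
  case (Suc k)
  let ?Q = "max_total P x y" and ?dem = "Inl (num_demand P)" and ?sup = "Inr (num_supply P)"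
  let ?u = "\<lambda>i. x i - (\<Sum>j=1..num_supply P. top_down x y ?Q i j)"
  let ?v = "\<lambda>j. y j - (\<Sum>i=1..num_demand P. top_down x y ?Q i j)"
  let ?x = "\<lambda>i. ?u i + new_demand P (t + 1) i \<omega>" and ?y = "\<lambda>j. ?v j + new_supply P (t + 1) j \<omega>"
  have t: "t \<in> {1..horizon P}" using Suc.prems by auto
  have Q: "?Q \<in> {0..max_total P x y}" using max_total_nonneg[OF Suc.prems(1)] by simp
  have "path_reward P (greedy_policy P) \<omega> (Suc k) t x y =
      period_reward P t (top_down x y ?Q) + path_reward P (greedy_policy P) \<omega> k (t + 1) ?x ?y"
    by (simp add: greedy_policy_def next_demand_def next_supply_def carry)
  also have "path_reward P (greedy_policy P) \<omega> k (t + 1) ?x ?y =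
    (\<Sum>\<kappa>\<in>classes P. greedy_class_reward k (t + 1) \<kappa> \<omega> (level ?x ?y \<kappa>)
        (level ?x ?y ?dem) (level ?x ?y ?sup))"
  \<comment> \<open>No sign condition is known for arrivals after the horizon, but with \<open>k = 0\<close> they are never used.\<close>
  proof (cases "k = 0")
    case True
    then show ?thesis by (simp add: greedy_class_reward_def)
  next
    case False
    have "is_state P ?x ?y"
      by (rule is_state_arrivals[OF is_state_remainder[OF Suc.prems(1) Q] _ assms(4)])
         (use Suc.prems False in auto)
    then show ?thesis using Suc.prems by (intro Suc.IH) auto
  qed
  also have "\<dots> = (\<Sum>\<kappa>\<in>classes P. greedy_class_reward k (t + 1) \<kappa> \<omega>
      (max (level x y \<kappa> - ?Q) 0 + arrived P (t + 1) \<omega> \<kappa>)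
      (level x y ?dem - ?Q + arrived P (t + 1) \<omega> ?dem)
      (level x y ?sup - ?Q + arrived P (t + 1) \<omega> ?sup))"
  proof -
    have "max (level x y ?dem - ?Q) 0 = level x y ?dem - ?Q"
      "max (level x y ?sup - ?Q) 0 = level x y ?sup - ?Q"
      by (simp_all add: max_total_level)
    then show ?thesis
      by (intro sum.cong refl)
         (simp only: level_arrivals level_remainder[OF Suc.prems(1) Q] total_classes)
  qed
  finally show ?case
    unfolding period_reward_top_down[OF t Suc.prems(1) Q]
    by (simp add: greedy_class_reward_def serve_def max_total_level sum.distrib)
qed

section \<open>The expected greedy continuation\<close>

lemma measurable_arrived:
  assumes s: "s \<in> {1..horizon P}" and \<kappa>: "\<kappa> \<in> classes P"
  shows "(\<lambda>\<omega>. arrived P s \<omega> \<kappa>) \<in> borel_measurable (prob_measure P)"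
proof (cases \<kappa>)
  case (Inl i)
  then have "new_demand P s l \<in> borel_measurable (prob_measure P)" if "l \<in> {1..i}" for l
    using s \<kappa> model that by (auto simp: matching_model_def classes_def)
  then have "(\<lambda>\<omega>. \<Sum>l=1..i. new_demand P s l \<omega>) \<in> borel_measurable (prob_measure P)"
    by (intro borel_measurable_sum)
  then show ?thesis using Inl by (simp add: arrived_def cumul_def)
next
  case (Inr j)
  then have "new_supply P s l \<in> borel_measurable (prob_measure P)" if "l \<in> {1..j}" for l
    using s \<kappa> model that by (auto simp: matching_model_def classes_def)
  then have "(\<lambda>\<omega>. \<Sum>l=1..j. new_supply P s l \<omega>) \<in> borel_measurable (prob_measure P)"
    by (intro borel_measurable_sum)
  then show ?thesis using Inr by (simp add: arrived_def cumul_def)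
qed

text \<open>The continuation averages twice: inside the greedy value over the arrivals after period \<open>t + 1\<close>, and
  outside over those of period \<open>t + 1\<close>. Both times \<open>expected_class_sum\<close> applies. If one of the integrals
  does not exist, or no period is left, the continuation vanishes identically and is represented by \<open>f = 0\<close> with \<open>g = 0\<close>.\<close>

lemma expected_continuation:
  assumes t: "t \<in> {1..horizon P}"
  obtains c g f where
    "\<And>\<kappa>. \<kappa> \<in> classes P \<Longrightarrow> shift_covariant (g \<kappa>) (f \<kappa>)"
    "\<And>\<kappa>. \<kappa> \<in> inner_classes P \<Longrightarrow> diminishing (g \<kappa>) (f \<kappa>)"
    "\<And>\<kappa>. \<kappa> \<in> inner_classes P \<Longrightarrow> g \<kappa> \<le> quality_gap rd rs t \<kappa>"
    "\<And>u v. is_state P u v \<Longrightarrow>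
       (\<integral>\<omega>. greedy_value P (t + 1) (\<lambda>i. u i + new_demand P (t + 1) i \<omega>)
               (\<lambda>j. v j + new_supply P (t + 1) j \<omega>) \<partial>prob_measure P)
       = c + (\<Sum>\<kappa>\<in>classes P. f \<kappa> (level u v \<kappa>)
                (level u v (Inl (num_demand P))) (level u v (Inr (num_supply P))))"
proof -
  note main = that
  let ?M = "prob_measure P" and ?dem = "Inl (num_demand P) :: nat + nat"
    and ?sup = "Inr (num_supply P) :: nat + nat"
  interpret prob_space ?M using model by (simp add: matching_model_def)
  let ?cont = "\<lambda>u v. (\<integral>\<omega>. greedy_value P (t + 1) (\<lambda>i. u i + new_demand P (t + 1) i \<omega>)
               (\<lambda>j. v j + new_supply P (t + 1) j \<omega>) \<partial>?M)"
  have zero: thesis if "\<And>u v. is_state P u v \<Longrightarrow> ?cont u v = 0"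
  proof (rule main[of "\<lambda>_. 0" "\<lambda>_ _ _ _. 0" 0])
    show "(0::real) \<le> quality_gap rd rs t \<kappa>" if "\<kappa> \<in> inner_classes P" for \<kappa>
      by (rule quality_gap_nonneg[OF t that])
    show "?cont u v = 0 + (\<Sum>\<kappa>\<in>classes P. 0)" if "is_state P u v" for u v
      using \<open>\<And>u v. is_state P u v \<Longrightarrow> ?cont u v = 0\<close>[OF that] by (simp only: sum.neutral_const)
  qed (simp_all add: shift_covariant_def diminishing_def concave_on_iff)
  show thesis
  proof (cases "t = horizon P")
    case True
    then show thesis
      by (intro zero) (simp add: greedy_value_def policy_value_def)
  next
    case False
    then have t': "t \<in> {1..<horizon P}" "t + 1 \<in> {1..horizon P}" using t by auto
    let ?k = "horizon P - t"
    have k: "?k \<noteq> 0" using t' by auto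
    let ?F = "greedy_class_reward ?k (t + 1)"
    obtain K where K: "\<And>\<kappa> \<omega>. lipschitz3 (K \<kappa>) (?F \<kappa> \<omega>)"
      using lipschitz3_class_reward[of "\<lambda>s. quality_gap rd rs s _" ?k "t + 1"]
      unfolding greedy_class_reward_def by metis
    have F_meas: "(\<lambda>\<omega>. ?F \<kappa> \<omega> a z w) \<in> borel_measurable ?M" if "\<kappa> \<in> classes P" for \<kappa> a z w
      unfolding greedy_class_reward_def
      by (rule measurable_class_reward) (use that total_classes in \<open>auto intro!: measurable_arrived\<close>)
    have F_shift: "shift_covariant (quality_gap rd rs (t + 1) \<kappa>) (?F \<kappa> \<omega>)" for \<kappa> \<omega>
      using shift_covariant_class_reward[of ?k] k by (simp add: greedy_class_reward_def)
    have F_dim: "diminishing (quality_gap rd rs (t + 1) \<kappa>) (?F \<kappa> \<omega>)"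
      if "\<kappa> \<in> inner_classes P" for \<kappa> \<omega>
    proof -
      have "\<kappa> \<in> classes P" using that inner_classes_subset by auto
      then show ?thesis
        using diminishing_class_reward[of "t + 1" ?k "\<lambda>s. quality_gap rd rs s \<kappa>"] k that
          quality_gap_nonneg[of _ \<kappa>] quality_gap_decreasing[of _ \<kappa>]
        by (simp add: greedy_class_reward_def)
    qed
    define base where "base \<omega> = 0 + (\<Sum>\<kappa>\<in>classes P. ?F \<kappa> \<omega> 0 0 0)" for \<omega>
    define G where "G \<kappa> = mean_change ?M (?F \<kappa>)" for \<kappa>
    have greedy_value_eq: "greedy_value P (t + 1) x y = (if integrable ?M base then integral\<^sup>L ?M base +
          (\<Sum>\<kappa>\<in>classes P. G \<kappa> (level x y \<kappa>) (level x y ?dem) (level x y ?sup)) else 0)"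
      if "is_state P x y" for x y
    proof -
      have "greedy_value P (t + 1) x y = (\<integral>\<omega>. 0 +
          (\<Sum>\<kappa>\<in>classes P. ?F \<kappa> \<omega> (level x y \<kappa>) (level x y ?dem) (level x y ?sup)) \<partial>?M)"
        unfolding greedy_value_def policy_value_def
        by (intro Bochner_Integration.integral_cong refl, subst greedy_path_reward)
           (use that t' in simp_all)
      also have "\<dots> = (if integrable ?M base then integral\<^sup>L ?M base +
          (\<Sum>\<kappa>\<in>classes P. G \<kappa> (level x y \<kappa>) (level x y ?dem) (level x y ?sup)) else 0)"
        unfolding base_def[abs_def] G_def
        by (rule expected_class_sum[OF finite_classes K F_meas])
      finally show ?thesis .
    qed
    show thesis
    proof (cases "integrable ?M base")
      case False
      show thesis
      proof (rule zero)
        fix u v assume "is_state P u v"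
        then have "?cont u v = (\<integral>\<omega>. 0 \<partial>?M)"
          using False t' by (intro Bochner_Integration.integral_cong refl, subst greedy_value_eq)
            (auto intro!: is_state_arrivals)
        then show "?cont u v = 0" by simp
      qed
    next
      case True
      define H where "H \<kappa> \<omega> a z w = G \<kappa> (a + arrived P (t + 1) \<omega> \<kappa>)
          (z + arrived P (t + 1) \<omega> ?dem) (w + arrived P (t + 1) \<omega> ?sup)" for \<kappa> \<omega> a z w
      have G_lip: "lipschitz3 (K \<kappa>) (G \<kappa>)" if "\<kappa> \<in> classes P" for \<kappa>
        unfolding G_def by (rule lipschitz3_mean_change[OF K F_meas[OF that]])
      have H_lip: "lipschitz3 (K \<kappa>) (H \<kappa> \<omega>)" if "\<kappa> \<in> classes P" for \<kappa> \<omega>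
        unfolding H_def[abs_def] by (rule lipschitz3_translate[OF G_lip[OF that]])
      have H_meas: "(\<lambda>\<omega>. H \<kappa> \<omega> a z w) \<in> borel_measurable ?M" if "\<kappa> \<in> classes P" for \<kappa> a z w
        unfolding H_def
        by (rule lipschitz3_measurable[OF G_lip[OF that]])
           (intro borel_measurable_add borel_measurable_const measurable_arrived t' that total_classes)+
      have H_shift: "shift_covariant (quality_gap rd rs (t + 1) \<kappa>) (H \<kappa> \<omega>)"
        if "\<kappa> \<in> classes P" for \<kappa> \<omega>
      proof -
        have "shift_covariant (quality_gap rd rs (t + 1) \<kappa>) (G \<kappa>)"
          unfolding G_def by (rule shift_covariant_mean_change[OF K F_meas[OF that] F_shift])
        then show ?thesis unfolding H_def[abs_def] by (rule shift_covariant_translate)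
      qed
      have H_dim: "diminishing (quality_gap rd rs (t + 1) \<kappa>) (H \<kappa> \<omega>)"
        if "\<kappa> \<in> inner_classes P" for \<kappa> \<omega>
      proof -
        have "\<kappa> \<in> classes P" using that inner_classes_subset by auto
        then have "diminishing (quality_gap rd rs (t + 1) \<kappa>) (G \<kappa>)"
          unfolding G_def by (rule diminishing_mean_change[OF K F_meas F_dim[OF that]])
        then show ?thesis unfolding H_def[abs_def] by (rule diminishing_translate)
      qed
      define base2 where "base2 \<omega> = integral\<^sup>L ?M base + (\<Sum>\<kappa>\<in>classes P. H \<kappa> \<omega> 0 0 0)" for \<omega>
      have cont: "?cont u v = (if integrable ?M base2 then integral\<^sup>L ?M base2 +
          (\<Sum>\<kappa>\<in>classes P. mean_change ?M (H \<kappa>) (level u v \<kappa>) (level u v ?dem) (level u v ?sup)) else 0)"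
        if "is_state P u v" for u v
      proof -
        have "?cont u v = (\<integral>\<omega>. integral\<^sup>L ?M base +
            (\<Sum>\<kappa>\<in>classes P. H \<kappa> \<omega> (level u v \<kappa>) (level u v ?dem) (level u v ?sup)) \<partial>?M)"
          by (intro Bochner_Integration.integral_cong refl, subst greedy_value_eq)
             (use that t' True in \<open>auto intro!: is_state_arrivals simp: level_arrivals H_def
               simp del: level_simps\<close>)
        also have "\<dots> = (if integrable ?M base2 then integral\<^sup>L ?M base2 +
          (\<Sum>\<kappa>\<in>classes P. mean_change ?M (H \<kappa>) (level u v \<kappa>) (level u v ?dem) (level u v ?sup)) else 0)"
          unfolding base2_def[abs_def]
          by (rule expected_class_sum[OF finite_classes H_lip H_meas])
        finally show ?thesis .
      qed
      show thesis
      proof (cases "integrable ?M base2")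
        case False
        then show thesis using cont by (intro zero) simp
      next
        case True
        show thesis
        proof (rule main)
          show "shift_covariant (quality_gap rd rs (t + 1) \<kappa>) (mean_change ?M (H \<kappa>))"
            if "\<kappa> \<in> classes P" for \<kappa>
            by (rule shift_covariant_mean_change[OF H_lip H_meas H_shift]) (rule that)+
          show "diminishing (quality_gap rd rs (t + 1) \<kappa>) (mean_change ?M (H \<kappa>))"
            if "\<kappa> \<in> inner_classes P" for \<kappa>
            by (rule diminishing_mean_change[OF H_lip H_meas H_dim[OF that]])
               (use that inner_classes_subset in auto)
          show "quality_gap rd rs (t + 1) \<kappa> \<le> quality_gap rd rs t \<kappa>"
            if "\<kappa> \<in> inner_classes P" for \<kappa>
            by (rule quality_gap_decreasing) (use that inner_classes_subset t' in auto)
        qed (use cont True in simp)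
      qed
    qed
  qed
qed

section \<open>The one-step-ahead objective\<close>

text \<open>Shift covariance moves \<open>Q\<close> out of the totals, so that it enters each summand only through a minimum, a
  maximum and a linear term.\<close>

lemma one_step_objective_class_sum:
  assumes t: "t \<in> {1..horizon P}"
  obtains c g f where
    "\<And>\<kappa>. \<kappa> \<in> classes P \<Longrightarrow> shift_covariant (g \<kappa>) (f \<kappa>)"
    "\<And>\<kappa>. \<kappa> \<in> inner_classes P \<Longrightarrow> diminishing (g \<kappa>) (f \<kappa>)"
    "\<And>\<kappa>. \<kappa> \<in> inner_classes P \<Longrightarrow> g \<kappa> \<le> quality_gap rd rs t \<kappa>"
    "\<And>x y Q. is_state P x y \<Longrightarrow> Q \<in> {0..max_total P x y} \<Longrightarrow>
       one_step_objective P t x y Q = c + (\<Sum>\<kappa>\<in>classes P.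
          quality_gap rd rs t \<kappa> * min (level x y \<kappa>) Q - g \<kappa> * Q +
          f \<kappa> (max (level x y \<kappa>) Q) (cumul x (num_demand P)) (cumul y (num_supply P)))"
proof -
  let ?dem = "Inl (num_demand P) :: nat + nat" and ?sup = "Inr (num_supply P) :: nat + nat"
  note main = that
  show thesis
  proof (rule expected_continuation[OF t])
    fix c g f assume sh: "\<And>\<kappa>. \<kappa> \<in> classes P \<Longrightarrow> shift_covariant (g \<kappa>) (f \<kappa>)"
    and *: "\<And>\<kappa>. \<kappa> \<in> inner_classes P \<Longrightarrow> diminishing (g \<kappa>) (f \<kappa>)"
    "\<And>\<kappa>. \<kappa> \<in> inner_classes P \<Longrightarrow> g \<kappa> \<le> quality_gap rd rs t \<kappa>"
    and cont: "\<And>u v. is_state P u v \<Longrightarrow>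
       (\<integral>\<omega>. greedy_value P (t + 1) (\<lambda>i. u i + new_demand P (t + 1) i \<omega>)
               (\<lambda>j. v j + new_supply P (t + 1) j \<omega>) \<partial>prob_measure P)
       = c + (\<Sum>\<kappa>\<in>classes P. f \<kappa> (level u v \<kappa>) (level u v ?dem) (level u v ?sup))"
    show thesis
  proof (rule main[OF sh *])
    fix x y Q assume st: "is_state P x y" and Q: "Q \<in> {0..max_total P x y}"
    let ?u = "\<lambda>i. x i - (\<Sum>j=1..num_supply P. top_down x y Q i j)"
    let ?v = "\<lambda>j. y j - (\<Sum>i=1..num_demand P. top_down x y Q i j)"
    have top: "max (level x y ?dem - Q) 0 = cumul x (num_demand P) - Q"
      "max (level x y ?sup - Q) 0 = cumul y (num_supply P) - Q"
      using Q by (simp_all add: max_total_def)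
    have "one_step_objective P t x y Q = period_reward P t (top_down x y Q) +
        (c + (\<Sum>\<kappa>\<in>classes P. f \<kappa> (level ?u ?v \<kappa>) (level ?u ?v ?dem) (level ?u ?v ?sup)))"
      using cont[OF is_state_remainder[OF st Q]]
      by (simp add: one_step_objective_def next_demand_def next_supply_def carry)
    also have "(\<Sum>\<kappa>\<in>classes P. f \<kappa> (level ?u ?v \<kappa>) (level ?u ?v ?dem) (level ?u ?v ?sup))
        = (\<Sum>\<kappa>\<in>classes P. f \<kappa> (max (level x y \<kappa>) Q) (cumul x (num_demand P)) (cumul y (num_supply P)) - g \<kappa> * Q)"
    proof (rule sum.cong[OF refl])
      fix \<kappa> assume \<kappa>: "\<kappa> \<in> classes P"
      have "f \<kappa> (level ?u ?v \<kappa>) (level ?u ?v ?dem) (level ?u ?v ?sup) =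
          f \<kappa> (max (level x y \<kappa>) Q - Q) (cumul x (num_demand P) - Q) (cumul y (num_supply P) - Q)"
        unfolding level_remainder[OF st Q \<kappa>] level_remainder[OF st Q total_classes(1)]
          level_remainder[OF st Q total_classes(2)] top
        by (rule arg_cong3[where f = "f \<kappa>"]) auto
      then show "f \<kappa> (level ?u ?v \<kappa>) (level ?u ?v ?dem) (level ?u ?v ?sup) =
          f \<kappa> (max (level x y \<kappa>) Q) (cumul x (num_demand P)) (cumul y (num_supply P)) - g \<kappa> * Q"
        using shift_covariantD[OF sh[OF \<kappa>]] by simp
    qed
    finally show "one_step_objective P t x y Q = c + (\<Sum>\<kappa>\<in>classes P.
          quality_gap rd rs t \<kappa> * min (level x y \<kappa>) Q - g \<kappa> * Q +
          f \<kappa> (max (level x y \<kappa>) Q) (cumul x (num_demand P)) (cumul y (num_supply P)))"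
      unfolding period_reward_top_down[OF t st Q] by (simp add: sum.distrib sum_subtractf)
  qed
  qed
qed

lemma one_step_objective_regular:
  assumes t: "t \<in> {1..horizon P}" and st: "is_state P x y"
  shows "concave_on {0..max_total P x y} (one_step_objective P t x y)"
    and "continuous_on {0..max_total P x y} (one_step_objective P t x y)"
proof -
  let ?S = "{0..max_total P x y}" and ?X = "cumul x (num_demand P)" and ?Y = "cumul y (num_supply P)"
  have "concave_on ?S (one_step_objective P t x y) \<and> continuous_on ?S (one_step_objective P t x y)"
  proof (rule one_step_objective_class_sum[OF t])
    fix c g f
    assume dim: "\<And>\<kappa>. \<kappa> \<in> inner_classes P \<Longrightarrow> diminishing (g \<kappa>) (f \<kappa>)"
      and gap: "\<And>\<kappa>. \<kappa> \<in> inner_classes P \<Longrightarrow> g \<kappa> \<le> quality_gap rd rs t \<kappa>"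
      and obj: "\<And>x y Q. is_state P x y \<Longrightarrow> Q \<in> {0..max_total P x y} \<Longrightarrow>
       one_step_objective P t x y Q = c + (\<Sum>\<kappa>\<in>classes P.
          quality_gap rd rs t \<kappa> * min (level x y \<kappa>) Q - g \<kappa> * Q +
          f \<kappa> (max (level x y \<kappa>) Q) (cumul x (num_demand P)) (cumul y (num_supply P)))"
    let ?term = "\<lambda>\<kappa> Q. quality_gap rd rs t \<kappa> * min (level x y \<kappa>) Q - g \<kappa> * Q +
          f \<kappa> (max (level x y \<kappa>) Q) ?X ?Y"
    have reg: "concave_on ?S (?term \<kappa>) \<and> continuous_on ?S (?term \<kappa>)" if \<kappa>: "\<kappa> \<in> classes P" for \<kappa>
    proof (cases "\<kappa> \<in> inner_classes P")
      case True
      have "concave_on UNIV (?term \<kappa>)" by (rule concave_on_class_term[OF dim[OF True] gap[OF True]])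
      then show ?thesis by (simp add: concave_on_UNIV_subset concave_on_UNIV_continuous)
    next
      case False
      then have "\<kappa> = Inl (num_demand P) \<or> \<kappa> = Inr (num_supply P)"
        using \<kappa> by (auto simp: classes_def inner_classes_def)
      then have "max_total P x y \<le> level x y \<kappa>" by (auto simp: max_total_def)
      then have eq: "?term \<kappa> Q = 0 + ((quality_gap rd rs t \<kappa> - g \<kappa>) * Q + f \<kappa> (level x y \<kappa>) ?X ?Y)"
        if "Q \<in> ?S" for Q
      proof -
        have "min (level x y \<kappa>) Q = Q" "max (level x y \<kappa>) Q = level x y \<kappa>"
          using that \<open>max_total P x y \<le> level x y \<kappa>\<close> by auto
        then show ?thesis by (simp add: left_diff_distrib)
      qed
      have "concave_on ?S (\<lambda>Q. 0 + ((quality_gap rd rs t \<kappa> - g \<kappa>) * Q + f \<kappa> (level x y \<kappa>) ?X ?Y))"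
        by (rule concave_on_affine_plus) (simp add: concave_on_const)
      then have "concave_on ?S (?term \<kappa>)" by (rule concave_on_cong[rotated]) (rule eq)
      moreover have "continuous_on ?S (?term \<kappa>)"
        by (subst continuous_on_cong[OF refl eq]) (auto intro!: continuous_intros)
      ultimately show ?thesis ..
    qed
    have conc_sum: "concave_on ?S (\<lambda>Q. c + (\<Sum>\<kappa>\<in>classes P. ?term \<kappa> Q))"
    proof (rule concave_on_add)
      show "concave_on ?S (\<lambda>Q. c)" by (simp add: concave_on_const)
      show "concave_on ?S (\<lambda>Q. \<Sum>\<kappa>\<in>classes P. ?term \<kappa> Q)"
        by (rule concave_on_sum_functions) (simp, simp, rule conjunct1[OF reg])
    qed
    have cont_sum: "continuous_on ?S (\<lambda>Q. c + (\<Sum>\<kappa>\<in>classes P. ?term \<kappa> Q))"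
    proof (intro continuous_on_add continuous_on_const)
      show "continuous_on ?S (\<lambda>Q. \<Sum>\<kappa>\<in>classes P. ?term \<kappa> Q)"
        by (rule continuous_on_sum) (rule conjunct2[OF reg])
    qed
    have eq: "one_step_objective P t x y Q = c + (\<Sum>\<kappa>\<in>classes P. ?term \<kappa> Q)"
      if "Q \<in> ?S" for Q
      by (rule obj[OF st that])
    from conc_sum have "concave_on ?S (one_step_objective P t x y)"
      by (rule concave_on_cong[rotated]) (rule eq)
    moreover have "continuous_on ?S (one_step_objective P t x y)"
      by (rule continuous_on_cong[THEN iffD2, OF refl eq cont_sum])
    ultimately show ?thesis ..
  qed
  then show "concave_on ?S (one_step_objective P t x y)"
    "continuous_on ?S (one_step_objective P t x y)" by auto
qed

text \<open>The maximizers form a compact set because the objective is continuous on a compact interval; so the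
  greatest one exists.\<close>

lemma greatest_one_step_maximizer:
  assumes t: "t \<in> {1..horizon P}" and st: "is_state P x y"
  obtains Q where "one_step_maximizer P t x y Q"
    "\<And>Q'. one_step_maximizer P t x y Q' \<Longrightarrow> Q' \<le> Q"
    "one_step_policy P t x y = top_down x y Q"
proof -
  let ?S = "{0..max_total P x y}" and ?H = "one_step_objective P t x y"
  have cont: "continuous_on ?S ?H" by (rule one_step_objective_regular[OF t st])
  have "?S \<noteq> {}" using max_total_nonneg[OF st] by simp
  then obtain Q\<^sub>0 where Q\<^sub>0: "Q\<^sub>0 \<in> ?S" "\<forall>Q\<in>?S. ?H Q \<le> ?H Q\<^sub>0"
    using continuous_attains_sup[OF compact_Icc _ cont] by blast
  have max_iff: "one_step_maximizer P t x y Q \<longleftrightarrow> Q \<in> ?S \<and> ?H Q \<ge> ?H Q\<^sub>0" for Q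
    using Q\<^sub>0 by (auto simp: one_step_maximizer_def intro: order_trans)
  let ?C = "?S \<inter> ?H -` {?H Q\<^sub>0..}"
  have "closed ?C" by (rule continuous_closed_preimage[OF cont closed_atLeastAtMost closed_atLeast])
  then have "compact (?S \<inter> ?C)" by (rule compact_Int_closed[OF compact_Icc])
  moreover have "?S \<inter> ?C \<noteq> {}" using Q\<^sub>0(1) by auto
  ultimately obtain Q where "Q \<in> ?S \<inter> ?C" "\<forall>Q'\<in>?S \<inter> ?C. Q' \<le> Q"
    using compact_attains_sup[of "?S \<inter> ?C"] by blast
  then have Q: "Q \<in> ?S" "?H Q \<ge> ?H Q\<^sub>0" "\<And>Q'. Q' \<in> ?S \<Longrightarrow> ?H Q' \<ge> ?H Q\<^sub>0 \<Longrightarrow> Q' \<le> Q"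
    by simp_all
  have "(GREATEST Q. one_step_maximizer P t x y Q) = Q"
    by (rule Greatest_equality) (use Q in \<open>auto simp: max_iff\<close>)
  then have "one_step_policy P t x y = top_down x y Q" by (simp add: one_step_policy_def)
  then show thesis by (rule that[rotated 2]) (use Q in \<open>auto simp: max_iff\<close>)
qed

text \<open>For \<open>Q\<close> in \<open>[L, M]\<close> the classes in \<open>E\<close>, those above demand type \<open>i\<close> and above supply type \<open>j\<close>, are exhausted: they have \<open>max a Q = Q\<close>, and
  shifting by the total demand leaves a function of \<open>z = x\<^sub>m - Q\<close> and \<open>b\<close>. All other classes have
  \<open>max a Q = a\<close> and are linear in \<open>Q\<close>. The second and third property of \<open>h\<close> are the increasing
  differences in total supply (which is \<open>z - b\<close>) and in total demand.\<close>

lemma matching_profile: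
  assumes t: "t \<in> {1..horizon P}" and i: "i \<in> {1..num_demand P}" and j: "j \<in> {1..num_supply P}"
  obtains h :: "real \<Rightarrow> real \<Rightarrow> real" where
    "\<And>b. concave_on UNIV (h b)"
    "\<And>b b' z z'. b \<le> b' \<Longrightarrow> z \<le> z' \<Longrightarrow> h b z' - h b z \<le> h b' z' - h b' z"
    "\<And>b b' z z'. b \<le> b' \<Longrightarrow> z \<le> z' \<Longrightarrow>
       h b' (z' + (b' - b)) - h b' (z + (b' - b)) \<le> h b z' - h b z"
    "\<And>x y Q Q'. is_state P x y \<Longrightarrow>
       {Q, Q'} \<subseteq> {max (cumul x (i - 1)) (cumul y (j - 1))..min (cumul x i) (cumul y j)} \<Longrightarrow>
       one_step_objective P t x y Q - one_step_objective P t x y Q' =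
       h (imbalance P x y) (cumul x (num_demand P) - Q) - h (imbalance P x y) (cumul x (num_demand P) - Q')"
proof (rule one_step_objective_class_sum[OF t])
  fix c g f
  assume sh: "\<And>\<kappa>. \<kappa> \<in> classes P \<Longrightarrow> shift_covariant (g \<kappa>) (f \<kappa>)"
    and dim: "\<And>\<kappa>. \<kappa> \<in> inner_classes P \<Longrightarrow> diminishing (g \<kappa>) (f \<kappa>)"
    and obj: "\<And>x y Q. is_state P x y \<Longrightarrow> Q \<in> {0..max_total P x y} \<Longrightarrow>
       one_step_objective P t x y Q = c + (\<Sum>\<kappa>\<in>classes P.
          quality_gap rd rs t \<kappa> * min (level x y \<kappa>) Q - g \<kappa> * Q +
          f \<kappa> (max (level x y \<kappa>) Q) (cumul x (num_demand P)) (cumul y (num_supply P)))"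
  define E :: "(nat + nat) set" where "E = {1..<i} <+> {1..<j}"
  define s where "s = (\<Sum>\<kappa>\<in>classes P - E. quality_gap rd rs t \<kappa> - g \<kappa>)"
  \<comment> \<open>By shift covariance this is \<open>f \<kappa> 0 z (z - b)\<close>, the reward of an exhausted class; in the present form
    \<open>z\<close> occurs only in the level.\<close>
  define p where "p \<kappa> b z = f \<kappa> (- z) 0 (- b) + g \<kappa> * z" for \<kappa> b z
  define h where "h b z = (\<Sum>\<kappa>\<in>E. p \<kappa> b z) + (- s * z + 0)" for b z
  have E: "finite E" "E \<subseteq> inner_classes P" "E \<subseteq> classes P"
    using i j by (auto simp: E_def inner_classes_def classes_def)
  have dimE: "diminishing (g \<kappa>) (f \<kappa>)" if "\<kappa> \<in> E" for \<kappa> using dim E that by blast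
  have shE: "shift_covariant (g \<kappa>) (f \<kappa>)" if "\<kappa> \<in> E" for \<kappa> using sh E that by blast
  show thesis
  proof (rule that[of h])
    fix b
    have "concave_on UNIV (p \<kappa> b)" if "\<kappa> \<in> E" for \<kappa>
    proof -
      have "concave_on UNIV (\<lambda>z. f \<kappa> (- z) 0 (- b))"
        by (rule concave_on_reflect[OF diminishing_concave[OF dimE[OF that]]])
      from concave_on_affine_plus[OF this, of "g \<kappa>" 0] show ?thesis by (simp add: p_def[abs_def])
    qed
    then show "concave_on UNIV (h b)"
      unfolding h_def[abs_def]
      by (intro concave_on_affine_plus concave_on_sum_functions E) auto
  next
    fix b b' z z' :: real assume b: "b \<le> b'" and z: "z \<le> z'"
    have "p \<kappa> b z' - p \<kappa> b z \<le> p \<kappa> b' z' - p \<kappa> b' z" if "\<kappa> \<in> E" for \<kappa>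
      using diminishing_differences[OF dimE[OF that], of "- z'" "- z" 0 0 "- b'" "- b"] b z
      by (simp add: p_def)
    then have "(\<Sum>\<kappa>\<in>E. p \<kappa> b z' - p \<kappa> b z) \<le> (\<Sum>\<kappa>\<in>E. p \<kappa> b' z' - p \<kappa> b' z)"
      by (rule sum_mono)
    then show "h b z' - h b z \<le> h b' z' - h b' z" by (simp add: h_def sum_subtractf)
  next
    fix b b' z z' :: real assume b: "b \<le> b'" and z: "z \<le> z'"
    let ?d = "b' - b"
    have shift: "p \<kappa> b' (e + ?d) = f \<kappa> (- e) ?d (- b) + g \<kappa> * e" if "\<kappa> \<in> E" for \<kappa> e
      using shift_covariantD[OF shE[OF that], of "- e" ?d ?d "- b"]
      by (simp add: p_def algebra_simps)
    have "p \<kappa> b' (z' + ?d) - p \<kappa> b' (z + ?d) \<le> p \<kappa> b z' - p \<kappa> b z" if "\<kappa> \<in> E" for \<kappa>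
      unfolding shift[OF that]
      using diminishing_differences[OF dimE[OF that], of "- z'" "- z" 0 ?d "- b" "- b"] b z
      by (simp add: p_def)
    then have "(\<Sum>\<kappa>\<in>E. p \<kappa> b' (z' + ?d) - p \<kappa> b' (z + ?d)) \<le> (\<Sum>\<kappa>\<in>E. p \<kappa> b z' - p \<kappa> b z)"
      by (rule sum_mono)
    then show "h b' (z' + ?d) - h b' (z + ?d) \<le> h b z' - h b z"
      by (simp add: h_def sum_subtractf algebra_simps)
  next
    fix x y Q Q'
    assume st: "is_state P x y"
      and QQ': "{Q, Q'} \<subseteq> {max (cumul x (i - 1)) (cumul y (j - 1))..min (cumul x i) (cumul y j)}"
    let ?X = "cumul x (num_demand P)" and ?Y = "cumul y (num_supply P)"
    have x: "\<And>k. k \<in> {1..num_demand P} \<Longrightarrow> 0 \<le> x k"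
      and y: "\<And>k. k \<in> {1..num_supply P} \<Longrightarrow> 0 \<le> y k" using st by (auto simp: is_state_def)
    note x_mono = cumul_mono[of "num_demand P" x, OF x] and y_mono = cumul_mono[of "num_supply P" y, OF y]
    have value_at: "one_step_objective P t x y q = h (imbalance P x y) (?X - q) +
        (c + (\<Sum>\<kappa>\<in>E. quality_gap rd rs t \<kappa> * level x y \<kappa>)
         + (s * ?X + (\<Sum>\<kappa>\<in>classes P - E. f \<kappa> (level x y \<kappa>) ?X ?Y)))"
      if "q \<in> {Q, Q'}" for q
    proof -
      have q: "cumul x (i - 1) \<le> q" "cumul y (j - 1) \<le> q" "q \<le> cumul x i" "q \<le> cumul y j"
        using that QQ' by auto
      have feasible: "q \<in> {0..max_total P x y}"
      proof -
        have "0 \<le> cumul x (i - 1)" using x_mono[of 0 "i - 1"] i by auto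
        moreover have "cumul x i \<le> ?X" "cumul y j \<le> ?Y" using x_mono y_mono i j by auto
        ultimately show ?thesis using q by (simp add: max_total_def)
      qed
      let ?term = "\<lambda>\<kappa>. quality_gap rd rs t \<kappa> * min (level x y \<kappa>) q - g \<kappa> * q +
          f \<kappa> (max (level x y \<kappa>) q) ?X ?Y"
      have exhausted: "?term \<kappa> = p \<kappa> (imbalance P x y) (?X - q) + quality_gap rd rs t \<kappa> * level x y \<kappa>"
        if "\<kappa> \<in> E" for \<kappa>
      proof -
        have "level x y \<kappa> \<le> q"
        proof (cases \<kappa>)
          case (Inl k)
          then have "cumul x k \<le> cumul x (i - 1)"
            using that i by (intro x_mono) (auto simp: E_def)
          then show ?thesis using Inl q(1) by simp
        next
          case (Inr k)
          then have "cumul y k \<le> cumul y (j - 1)"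
            using that j by (intro y_mono) (auto simp: E_def)
          then show ?thesis using Inr q(2) by simp
        qed
        moreover have "f \<kappa> (q - ?X) (?X - ?X) (?Y - ?X) = f \<kappa> q ?X ?Y - g \<kappa> * ?X"
          by (rule shift_covariantD[OF shE[OF that]])
        ultimately show ?thesis by (simp add: p_def imbalance_def max_def min_def algebra_simps)
      qed
      have waiting: "?term \<kappa> = (quality_gap rd rs t \<kappa> - g \<kappa>) * q + f \<kappa> (level x y \<kappa>) ?X ?Y"
        if "\<kappa> \<in> classes P - E" for \<kappa>
      proof -
        have "q \<le> level x y \<kappa>"
        proof (cases \<kappa>)
          case (Inl k)
          then have "cumul x i \<le> cumul x k"
            using that by (intro x_mono) (auto simp: E_def classes_def)
          then show ?thesis using Inl q(3) by simp
        next
          case (Inr k)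
          then have "cumul y j \<le> cumul y k"
            using that by (intro y_mono) (auto simp: E_def classes_def)
          then show ?thesis using Inr q(4) by simp
        qed
        then show ?thesis by (simp add: max_def min_def left_diff_distrib)
      qed
      have "one_step_objective P t x y q = c + ((\<Sum>\<kappa>\<in>classes P - E. ?term \<kappa>) + (\<Sum>\<kappa>\<in>E. ?term \<kappa>))"
        unfolding obj[OF st feasible] by (subst sum.subset_diff[OF E(3) finite_classes]) simp
      moreover have "(\<Sum>\<kappa>\<in>E. ?term \<kappa>) = (\<Sum>\<kappa>\<in>E. p \<kappa> (imbalance P x y) (?X - q))
          + (\<Sum>\<kappa>\<in>E. quality_gap rd rs t \<kappa> * level x y \<kappa>)"
        by (simp only: sum.distrib[symmetric]) (rule sum.cong[OF refl exhausted])
      moreover have "(\<Sum>\<kappa>\<in>classes P - E. ?term \<kappa>)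
          = s * q + (\<Sum>\<kappa>\<in>classes P - E. f \<kappa> (level x y \<kappa>) ?X ?Y)"
        by (simp only: s_def sum_distrib_right sum.distrib[symmetric]) (rule sum.cong[OF refl waiting])
      ultimately show ?thesis by (simp add: h_def right_diff_distrib)
    qed
    show "one_step_objective P t x y Q - one_step_objective P t x y Q' =
       h (imbalance P x y) (?X - Q) - h (imbalance P x y) (?X - Q')"
      by (simp add: value_at)
  qed
qed

end

section \<open>Protection levels of the one-step-ahead policy\<close>

theorem proposition11:
  fixes P :: "'w matching_model" and rd rs :: "nat \<Rightarrow> nat \<Rightarrow> real" and i j t :: nat
  assumes "matching_model P"
    and "vertical_rewards P rd rs"
    and "carry_demand P = 1" and "carry_supply P = 1"
    and "i \<in> {1..num_demand P}" and "j \<in> {1..num_supply P}" and "t \<in> {1..horizon P}"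
  shows "\<exists>pd ps :: real \<Rightarrow> ereal.
     (\<forall>b. pd b \<noteq> -\<infinity> \<and> ps b \<noteq> -\<infinity> \<and> pd b = ps b + ereal b) \<and>
     (\<forall>x y. is_state P x y \<longrightarrow>
        (one_step_policy P t x y i j > 0 \<longrightarrow>
           cumul x i > cumul y (j - 1) \<and> cumul y j > cumul x (i - 1)) \<and>
        (cumul x i > cumul y (j - 1) \<and> cumul y j > cumul x (i - 1) \<longrightarrow>
           (let L = max (cumul x (i - 1)) (cumul y (j - 1));
                M = min (cumul x i) (cumul y j);
                b = imbalance P x y
            in ereal (one_step_policy P t x y i j) =
                 min (ereal (M - L)) (max 0 (ereal (cumul x (num_demand P) - L) - pd b)) \<and>
               ereal (one_step_policy P t x y i j) =
                 min (ereal (M - L)) (max 0 (ereal (cumul y (num_supply P) - L) - ps b))))) \<and>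
     (\<forall>b b'. b \<le> b' \<longrightarrow>
        pd b \<le> pd b' \<and> pd b' \<le> pd b + ereal (b' - b) \<and>
        ps b' \<le> ps b \<and> ps b \<le> ps b' + ereal (b' - b))"
proof (rule matching_profile[OF assms(1-4,7,5,6)])
  note model = assms(1-4) and i = assms(5) and j = assms(6) and t = assms(7)
  fix h :: "real \<Rightarrow> real \<Rightarrow> real"
  assume conc: "\<And>b. concave_on UNIV (h b)"
    and incr: "\<And>b b' z z'. b \<le> b' \<Longrightarrow> z \<le> z' \<Longrightarrow> h b z' - h b z \<le> h b' z' - h b' z"
    and decr: "\<And>b b' z z'. b \<le> b' \<Longrightarrow> z \<le> z' \<Longrightarrow>
       h b' (z' + (b' - b)) - h b' (z + (b' - b)) \<le> h b z' - h b z"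
    and obj: "\<And>x y Q Q'. is_state P x y \<Longrightarrow>
       {Q, Q'} \<subseteq> {max (cumul x (i - 1)) (cumul y (j - 1))..min (cumul x i) (cumul y j)} \<Longrightarrow>
       one_step_objective P t x y Q - one_step_objective P t x y Q' =
       h (imbalance P x y) (cumul x (num_demand P) - Q) - h (imbalance P x y) (cumul x (num_demand P) - Q')"
  \<comment> \<open>The remaining demand is at least \<open>max 0 b\<close>, because at most all of the scarcer side is matched.\<close>
  define pd where "pd b = protection_level (max 0 b) (h b)" for b
  define ps where "ps b = pd b - ereal b" for b
  have pd_ge: "ereal (max 0 b) \<le> pd b" for b unfolding pd_def by (rule protection_level_ge)
  then have pd_cases: "pd b = \<infinity> \<or> (\<exists>r. pd b = ereal r)" for b
    by (metis MInfty_neq_ereal(1) ereal_infty_less_eq(2) uminus_ereal.elims)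
  have basic: "pd b \<noteq> -\<infinity> \<and> ps b \<noteq> -\<infinity> \<and> pd b = ps b + ereal b" for b
    using pd_cases[of b] by (auto simp: ps_def)
  have mono: "pd b \<le> pd b' \<and> pd b' \<le> pd b + ereal (b' - b) \<and>
        ps b' \<le> ps b \<and> ps b \<le> ps b' + ereal (b' - b)" if b: "b \<le> b'" for b b'
  proof -
    have "pd b \<le> pd b' + ereal 0"
      unfolding pd_def by (rule protection_level_mono) (use b incr in auto)
    moreover have "pd b' \<le> pd b + ereal (b' - b)"
      unfolding pd_def by (rule protection_level_mono) (use b decr in auto)
    ultimately show ?thesis
      using pd_cases[of b] pd_cases[of b'] by (auto simp: ps_def)
  qed
  have policy: "(one_step_policy P t x y i j > 0 \<longrightarrow>
           cumul x i > cumul y (j - 1) \<and> cumul y j > cumul x (i - 1)) \<and>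
        (cumul x i > cumul y (j - 1) \<and> cumul y j > cumul x (i - 1) \<longrightarrow>
           (let L = max (cumul x (i - 1)) (cumul y (j - 1));
                M = min (cumul x i) (cumul y j);
                b = imbalance P x y
            in ereal (one_step_policy P t x y i j) =
                 min (ereal (M - L)) (max 0 (ereal (cumul x (num_demand P) - L) - pd b)) \<and>
               ereal (one_step_policy P t x y i j) =
                 min (ereal (M - L)) (max 0 (ereal (cumul y (num_supply P) - L) - ps b))))"
    if st: "is_state P x y" for x y
  proof -
    define L M X Y b where "L = max (cumul x (i - 1)) (cumul y (j - 1))"
      and "M = min (cumul x i) (cumul y j)" and "X = cumul x (num_demand P)"
      and "Y = cumul y (num_supply P)" and "b = imbalance P x y"
    let ?H = "one_step_objective P t x y" and ?S = "{0..max_total P x y}"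
    have x: "\<And>k. k \<in> {1..num_demand P} \<Longrightarrow> 0 \<le> x k"
      and y: "\<And>k. k \<in> {1..num_supply P} \<Longrightarrow> 0 \<le> y k" using st by (auto simp: is_state_def)
    note x_mono = cumul_mono[of "num_demand P" x, OF x] and y_mono = cumul_mono[of "num_supply P" y, OF y]
    have b: "b = X - Y" by (simp add: b_def X_def Y_def imbalance_def)
    have "0 \<le> cumul x (i - 1)" using x_mono[of 0 "i - 1"] i by auto
    then have L: "0 \<le> L" by (simp add: L_def le_max_iff_disj)
    have M: "M \<le> X" "M \<le> Y"
      using x_mono[of i "num_demand P"] y_mono[of j "num_supply P"] i j
      by (auto simp: M_def X_def Y_def min_le_iff_disj)
    then have S: "{L..M} \<subseteq> ?S" using L by (auto simp: max_total_def X_def Y_def)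
    have H: "?H Q - ?H Q' = h b (X - Q) - h b (X - Q')" if "Q \<in> {L..M}" "Q' \<in> {L..M}" for Q Q'
      using obj[OF st, of Q Q'] that by (simp add: L_def M_def X_def b_def)
    have Hc: "concave_on ?S ?H" by (rule one_step_objective_regular[OF model t st])
    obtain Qs where Qs: "one_step_maximizer P t x y Qs"
      "\<And>Q'. one_step_maximizer P t x y Q' \<Longrightarrow> Q' \<le> Qs"
      "one_step_policy P t x y = top_down x y Qs"
      using greatest_one_step_maximizer[OF model t st] by blast
    have QsS: "Qs \<in> ?S" and best: "?H Q \<le> ?H Qs" if "Q \<in> ?S" for Q
      using Qs(1) that by (auto simp: one_step_maximizer_def)
    have strict: "?H Q < ?H Qs" if "Q \<in> ?S" "Qs < Q" for Q
    proof (rule ccontr)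
      assume "\<not> ?H Q < ?H Qs"
      then have "one_step_maximizer P t x y Q"
        using that(1) best by (force simp: one_step_maximizer_def)
      then show False using Qs(2) that(2) by force
    qed
    have q: "one_step_policy P t x y i j = max 0 (min M Qs - L)"
      by (simp add: Qs(3) top_down_def L_def M_def)
    \<comment> \<open>As long as the remaining demand exceeds the protection level, matching does no harm. Were the
      greatest maximizer smaller than \<open>Q\<close>, the objective would fall strictly just before \<open>Q\<close>.\<close>
    have keep: "Q \<le> Qs" if Q: "L < Q" "Q \<le> M" and above: "pd b < ereal (X - Q)" for Q
    proof (rule ccontr)
      assume "\<not> Q \<le> Qs"
      define Q' where "Q' = (max L Qs + Q) / 2"
      have Q': "L < Q'" "Qs < Q'" "Q' < Q"
        using \<open>\<not> Q \<le> Qs\<close> Q by (auto simp: Q'_def field_simps max_def)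
      have QS: "Q \<in> ?S" using Q S by auto
      have "?H Q < ?H Q'"
        by (rule concave_on_drop_is_final[OF Hc _ QS Q'(2,3)])
           (use QsS[OF QS] strict[OF QS] \<open>\<not> Q \<le> Qs\<close> in auto)
      then have "h b (X - Q) < h b (X - Q')" using H[of Q Q'] Q Q' by auto
      moreover have "h b (X - Q') \<le> h b (X - Q)"
        using above_protection_level[OF conc above[unfolded pd_def]] Q' by simp
      ultimately show False by simp
    qed
    \<comment> \<open>Conversely, a maximizer that is at least \<open>Q\<close> makes the objective nondecreasing on \<open>[L, Q]\<close>, so \<open>h b\<close>
      does not rise just beyond \<open>X - Q\<close> and, being concave, never again.\<close>
    have stop: "Qs < Q" if Q: "L < Q" "Q \<le> M" and below: "ereal (X - Q) < pd b" for Q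
    proof (rule ccontr)
      assume "\<not> Qs < Q"
      have QS: "Q \<in> ?S" using Q S by auto
      have up: "?H Q' \<le> ?H Q" if Q': "L \<le> Q'" "Q' < Q" for Q'
      proof (rule ccontr)
        assume down: "\<not> ?H Q' \<le> ?H Q"
        have Q'S: "Q' \<in> ?S" using Q Q' S by auto
        have "Q < Qs" using down best[OF Q'S] \<open>\<not> Qs < Q\<close> by (cases "Q = Qs") auto
        then have "?H Qs \<le> ?H Q"
          by (intro concave_on_decrease_persists[OF Hc Q'S QsS[OF QS] Q'(2)]) (use down in auto)
        then show False using best[OF Q'S] down by simp
      qed
      have "pd b \<le> ereal (X - Q)"
        unfolding pd_def
      proof (rule protection_level_le)
        show "max 0 b \<le> X - Q" using M Q by (simp add: b)
        fix z' assume z': "z' > X - Q"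
        have near: "h b (X - Q') \<le> h b (X - Q)" if "L \<le> Q'" "Q' < Q" for Q'
          using up[OF that] H[of Q' Q] that Q by auto
        show "h b z' \<le> h b (X - Q)"
        proof (cases "z' \<le> X - L")
          case True
          then show ?thesis using near[of "X - z'"] z' by simp
        next
          case False
          have "h b z' \<le> h b (X - L)"
            by (rule concave_on_decrease_persists[OF conc, of "X - Q"]) (use False Q near[of L] in auto)
          then show ?thesis using near[of L] Q by simp
        qed
      qed
      then show False using below by simp
    qed
    have demand: "ereal (max 0 (min M Qs - L)) = min (ereal (M - L)) (max 0 (ereal (X - L) - pd b))"
      if "L \<le> M"
    proof (cases "pd b = \<infinity>")
      case True
      have "max 0 (min M Qs - L) = min (M - L) (max 0 (L - L))"
        by (rule clamp_eqI[OF that]) (use stop True in auto)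
      then show ?thesis using True that by simp
    next
      case False
      then obtain r where r: "pd b = ereal r" using pd_cases by blast
      have "max 0 (min M Qs - L) = min (M - L) (max 0 ((X - r) - L))"
        by (rule clamp_eqI[OF that]) (use keep stop r in auto)
      then show ?thesis by (simp add: r zero_ereal_def algebra_simps)
    qed
    have excess: "ereal (Y - L) - ps b = ereal (X - L) - pd b"
      using pd_cases[of b] by (auto simp: ps_def b)
    have LM: "L \<le> M" if "cumul x i > cumul y (j - 1)" "cumul y j > cumul x (i - 1)"
      using that x_mono[of "i - 1" i] y_mono[of "j - 1" j] i j by (auto simp: L_def M_def)
    have "cumul x i > cumul y (j - 1) \<and> cumul y j > cumul x (i - 1)" if "one_step_policy P t x y i j > 0"
      using that unfolding q by (auto simp: L_def M_def max_def min_def split: if_splits)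
    then show ?thesis
      unfolding Let_def L_def[symmetric] M_def[symmetric] b_def[symmetric] X_def[symmetric]
        Y_def[symmetric] excess
      using LM demand q by auto
  qed
  show ?thesis
    by (rule exI[of _ pd], rule exI[of _ ps], intro conjI)
       (intro allI, rule basic, intro allI impI, rule policy, assumption,
        intro allI impI, rule mono, assumption)
qed

end
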